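(* Let $f\in\mathcal{C}^0(\Omega,\mathbb{R}^3)$, $g=(f,0)\in Y$, and $u^0\in Z$. Then there exists a unique $V^{\sharp}\in X_{T_0}^{\sharp}$ such that $\widehat{T}_0^{\sharp}V^{\sharp}=(g,u^0)$, where $(g,u^0)\in Y\times Z$ is regarded as an element of $(Y\times Z)^{\sharp}$ via the canonical embedding.
   Context: Let $\Omega=\mathbb{R}^3\times[0,\infty)$ with the Euclidean (subspace) topology, and fix $\nu\in\mathbb{R}$. For a topological space $W$ and $x\in W$ let $\mathcal{V}_x$ be its neighbourhoods; for $u:W\to[-\infty,\infty]$, $I(u)(x)=\sup_{V\in\mathcal{V}_x}\inf_{y\in V}u(y)$ and $S(u)(x)=\inf_{V\in\mathcal{V}_x}\sup_{y\in V}u(y)$. $u$ is normal lower semi-continuous if $(I\circ S)(u)=u$, nearly finite if $\{u\in\mathbb{R}\}$ is open dense. $\mathcal{ML}^0(\Omega)$ is the set of nearly finite normal lower semi-continuous $u$ on $\Omega$ that are real valued and continuous off some closed nowhere dense $\Gamma\subset\Omega$, ordered pointwise. For $m\in\mathbb{N}$, $\mathcal{ML}^m_0(\Omega)=\{u\in\mathcal{ML}^0(\Omega): u(\cdot,0)\in\mathcal{C}^m(\mathbb{R}^3)$ and $u\in\mathcal{C}^m(\Omega\setminus\Gamma)$ for some closed nowhere dense $\Gamma\subset\Omega\}$. Set $X=\mathcal{ML}^2_0(\Omega)^4$, $Y=\mathcal{ML}^0(\Omega)^4$, $Z=\mathcal{C}^2(\mathbb{R}^3,\mathbb{R}^3)$.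 For $v=(u_1,u_2,u_3,p)\in X$ define $Tv=(T_1v,\dots,T_4v)\in Y$ by $T_iv=(I\circ S)\big(\frac{\partial u_i}{\partial t}+\sum_{j=1}^3u_j\frac{\partial u_j}{\partial x_i}-\nu\sum_{j=1}^3\frac{\partial^2u_i}{\partial x_j^2}+\frac{\partial p}{\partial x_i}\big)$, $i=1,2,3$, and $T_4v=(I\circ S)\big(\sum_{i=1}^3\frac{\partial u_i}{\partial x_i}\big)$, the expressions being computed classically on the open dense set where all components are $\mathcal{C}^2$ and extended by $0$ elsewhere. Let $R_0v=(u_1,u_2,u_3)(\cdot,0)\in Z$ and $T_0v=(Tv,R_0v)\in Y\times Z$. Let $v\sim_{T_0}w$ iff $T_0v=T_0w$, $X_{T_0}=X/\sim_{T_0}$, and $\widehat{T}_0:X_{T_0}\to Y\times Z$ the induced injective map. Uniform structure on $\mathcal{ML}^0(\Omega)$: with $\tau$ the topology of $\Omega$, order intervals $[a,b]=\{w:a\le w\le b\}$, $F_{|V}=\{w_{|V}:w\in F\}$, and $[\Sigma_i]$ the filter generated by the members of a decreasing sequence $\Sigma_i$, $\mathcal{J}_o$ is the family of filters $\mathcal{U}$ on $\mathcal{ML}^0(\Omega)^2$ for which there exist $k$ and decreasing sequences $\Sigma_i=(I^i_n)_n$ of nonempty order intervals, $i=1,\dots,k$, with $\bigcap_{i=1}^k([\Sigma_i]\times[\Sigma_i])\subseteq\mathcal{U}$ and, for all $i$ and $V\in\tau$, either $\bigcap_n(I^i_n)_{|V}=\{u_{i|V}\}$ for some $u_i\in\mathcal{ML}^0(\Omega)$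 or $\bigcap_n(I^i_n)_{|V}=\emptyset$. $Y$ carries the product uniform convergence structure of $\mathcal{J}_o$; $Z$ carries $\mathcal{J}_\lambda$: a filter $\mathcal{U}$ on $Z\times Z$ is in $\mathcal{J}_\lambda$ iff there are $u_1,\dots,u_k\in Z$ with $\bigcap_{j=1}^k([u_j]\times[u_j])\subseteq\mathcal{U}$; $Y\times Z$ carries the product structure $\mathcal{J}_P$. $X_{T_0}$ carries the initial structure $\mathcal{J}_{T_0}$: $\mathcal{U}\in\mathcal{J}_{T_0}$ iff $(\widehat{T}_0\times\widehat{T}_0)(\mathcal{U})\in\mathcal{J}_P$. $X_{T_0}^{\sharp}$ and $(Y\times Z)^{\sharp}$ are the uniform convergence space completions (Beattie–Butzmann) of $X_{T_0}$ and $Y\times Z$, and $\widehat{T}_0^{\sharp}:X_{T_0}^{\sharp}\to(Y\times Z)^{\sharp}$ is the uniformly continuous extension of $\widehat{T}_0$. *)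

theory Defs
  imports "HOL-Analysis.Analysis"
begin

definition nbhds_of :: "'a topology \<Rightarrow> 'a \<Rightarrow> 'a set set" where
  "nbhds_of W x = {V. V \<subseteq> topspace W \<and> (\<exists>U. openin W U \<and> x \<in> U \<and> U \<subseteq> V)}"

definition lowerI :: "'a topology \<Rightarrow> ('a \<Rightarrow> ereal) \<Rightarrow> 'a \<Rightarrow> ereal" where
  "lowerI W u x = (SUP V \<in> nbhds_of W x. INF y \<in> V. u y)"

definition upperS :: "'a topology \<Rightarrow> ('a \<Rightarrow> ereal) \<Rightarrow> 'a \<Rightarrow> ereal" where
  "upperS W u x = (INF V \<in> nbhds_of W x. SUP y \<in> V. u y)"

definition IS :: "'a topology \<Rightarrow> ('a \<Rightarrow> ereal) \<Rightarrow> 'a \<Rightarrow> ereal" where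
  "IS W u = (\<lambda>x. if x \<in> topspace W then lowerI W (upperS W u) x else 0)"

definition nlsc :: "'a topology \<Rightarrow> ('a \<Rightarrow> ereal) \<Rightarrow> bool" where
  "nlsc W u \<longleftrightarrow> (\<forall>x\<in>topspace W. lowerI W (upperS W u) x = u x)"

definition nearly_finite :: "'a topology \<Rightarrow> ('a \<Rightarrow> ereal) \<Rightarrow> bool" where
  "nearly_finite W u \<longleftrightarrow>
     openin W {x \<in> topspace W. \<bar>u x\<bar> \<noteq> \<infinity>} \<and>
     W closure_of {x \<in> topspace W. \<bar>u x\<bar> \<noteq> \<infinity>} = topspace W"

definition closed_nowhere_dense :: "'a topology \<Rightarrow> 'a set \<Rightarrow> bool" where
  "closed_nowhere_dense W G \<longleftrightarrow> closedin W G \<and> W interior_of G = {}"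

text \<open>ML^0(W): functions on topspace W, represented extensionally (value 0 off the space).\<close>
definition ML0 :: "'a topology \<Rightarrow> ('a \<Rightarrow> ereal) set" where
  "ML0 W = {u. (\<forall>x. x \<notin> topspace W \<longrightarrow> u x = 0) \<and> nearly_finite W u \<and> nlsc W u \<and>
      (\<exists>G. closed_nowhere_dense W G \<and> (\<forall>x\<in>topspace W - G. \<bar>u x\<bar> \<noteq> \<infinity>) \<and>
           continuous_map (subtopology W (topspace W - G)) euclideanreal (\<lambda>x. real_of_ereal (u x)))}"

text \<open>C^k on a set A (derivatives taken within A; one-sided at boundary points).\<close>
fun Ck :: "nat \<Rightarrow> 'a::real_normed_vector set \<Rightarrow> ('a \<Rightarrow> real) \<Rightarrow> bool" where
  "Ck 0 A h = continuous_on A h"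
| "Ck (Suc k) A h = ((\<forall>x\<in>A. h differentiable (at x within A)) \<and>
      (\<forall>v. Ck k A (\<lambda>x. frechet_derivative h (at x within A) v)))"

section \<open>Uniform convergence spaces and their completion (Beattie--Butzmann)\<close>

text \<open>A uniform convergence structure on a carrier S is a set J of filters on S x S.
  Filters are proper.\<close>

definition ucs_cauchy :: "'a set \<Rightarrow> ('a \<times> 'a) filter set \<Rightarrow> 'a filter \<Rightarrow> bool" where
  "ucs_cauchy S J F \<longleftrightarrow> F \<noteq> bot \<and> eventually (\<lambda>x. x \<in> S) F \<and> F \<times>\<^sub>F F \<in> J"

text \<open>Equivalence class of a Cauchy filter: G ~ F iff the intersection F \<inter> G
  (which is sup in Isabelle's filter order) is Cauchy.\<close>
definition ucs_class :: "'a set \<Rightarrow> ('a \<times> 'a) filter set \<Rightarrow> 'a filter \<Rightarrow> 'a filter set" where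
  "ucs_class S J F = {G. ucs_cauchy S J G \<and> ucs_cauchy S J (sup F G)}"

text \<open>Completion: all classes of Cauchy filters; a point x is identified with the class of
  the principal filter [x] (which consists of the filters converging to x).\<close>
definition ucs_completion :: "'a set \<Rightarrow> ('a \<times> 'a) filter set \<Rightarrow> 'a filter set set" where
  "ucs_completion S J = {ucs_class S J F | F. ucs_cauchy S J F}"

definition ucs_embed :: "'a set \<Rightarrow> ('a \<times> 'a) filter set \<Rightarrow> 'a \<Rightarrow> 'a filter set" where
  "ucs_embed S J x = ucs_class S J (principal {x})"

definition ucs_ext :: "'b set \<Rightarrow> ('b \<times> 'b) filter set \<Rightarrow> ('a \<Rightarrow> 'b) \<Rightarrow> 'a filter set \<Rightarrow> 'b filter set" where
  "ucs_ext S' J' T \<xi> = ucs_class S' J' (filtermap T (SOME F. F \<in> \<xi>))"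

type_synonym pt = "(real^3) \<times> real"
type_synonym mlf = "pt \<Rightarrow> ereal"
type_synonym xel = "(3 \<Rightarrow> mlf) \<times> mlf"  (* (velocity components u_1..u_3, pressure p) *)

definition Om :: "pt set" where "Om = {p. snd p \<ge> 0}"

definition Wt :: "pt topology" where "Wt = top_of_set Om"

abbreviation ur :: "mlf \<Rightarrow> pt \<Rightarrow> real" where "ur u \<equiv> (\<lambda>p. real_of_ereal (u p))"

definition ML2_0 :: "mlf set" where
  "ML2_0 = {u \<in> ML0 Wt. (\<forall>x. \<bar>u (x,0)\<bar> \<noteq> \<infinity>) \<and> Ck 2 UNIV (\<lambda>x. real_of_ereal (u (x,0))) \<and>
      (\<exists>G. closed_nowhere_dense Wt G \<and> (\<forall>p\<in>Om - G. \<bar>u p\<bar> \<noteq> \<infinity>) \<and> Ck 2 (Om - G) (ur u))}"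

definition Xset :: "xel set" where
  "Xset = {(U, P). (\<forall>j. U j \<in> ML2_0) \<and> P \<in> ML2_0}"

definition Yset :: "xel set" where
  "Yset = {(U, P). (\<forall>j. U j \<in> ML0 Wt) \<and> P \<in> ML0 Wt}"

definition Zset :: "(real^3 \<Rightarrow> real^3) set" where
  "Zset = {w. \<forall>j. Ck 2 UNIV (\<lambda>x. w x $ j)}"

definition YZset :: "(xel \<times> (real^3 \<Rightarrow> real^3)) set" where
  "YZset = Yset \<times> Zset"

text \<open>Set where all components are C^2 (open dense for elements of X).\<close>
definition Dset :: "xel \<Rightarrow> pt set" where
  "Dset v = {p \<in> Om. \<exists>A. openin Wt A \<and> p \<in> A \<and> (\<forall>j. Ck 2 A (ur (fst v j))) \<and> Ck 2 A (ur (snd v))}"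

definition dd :: "(pt \<Rightarrow> real) \<Rightarrow> pt \<Rightarrow> pt \<Rightarrow> real" where
  "dd h e p = frechet_derivative h (at p within Om) e"

definition ex :: "3 \<Rightarrow> pt" where "ex j = (axis j 1, 0)"
definition et :: pt where "et = (0, 1)"

definition NS_expr :: "real \<Rightarrow> xel \<Rightarrow> 3 \<Rightarrow> mlf" where
  "NS_expr \<nu> v i = (\<lambda>p. if p \<in> Dset v then
      ereal (dd (ur (fst v i)) et p
             + (\<Sum>j\<in>UNIV. ur (fst v j) p * dd (ur (fst v j)) (ex i) p)
             - \<nu> * (\<Sum>j\<in>UNIV. dd (\<lambda>q. dd (ur (fst v i)) (ex j) q) (ex j) p)
             + dd (ur (snd v)) (ex i) p)
     else 0)"

definition div_expr :: "xel \<Rightarrow> mlf" where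
  "div_expr v = (\<lambda>p. if p \<in> Dset v then ereal (\<Sum>i\<in>UNIV. dd (ur (fst v i)) (ex i) p) else 0)"

definition Top :: "real \<Rightarrow> xel \<Rightarrow> xel" where
  "Top \<nu> v = ((\<lambda>i. IS Wt (NS_expr \<nu> v i)), IS Wt (div_expr v))"

definition R0 :: "xel \<Rightarrow> (real^3 \<Rightarrow> real^3)" where
  "R0 v = (\<lambda>x. \<chi> j. real_of_ereal (fst v j (x, 0)))"

definition T0 :: "real \<Rightarrow> xel \<Rightarrow> xel \<times> (real^3 \<Rightarrow> real^3)" where
  "T0 \<nu> v = (Top \<nu> v, R0 v)"

definition XT0 :: "real \<Rightarrow> xel set set" where
  "XT0 \<nu> = Xset // {(v, w). v \<in> Xset \<and> w \<in> Xset \<and> T0 \<nu> v = T0 \<nu> w}"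

definition T0hat :: "real \<Rightarrow> xel set \<Rightarrow> xel \<times> (real^3 \<Rightarrow> real^3)" where
  "T0hat \<nu> c = T0 \<nu> (SOME v. v \<in> c)"

definition ointerval :: "mlf \<Rightarrow> mlf \<Rightarrow> mlf set" where
  "ointerval a b = {w \<in> ML0 Wt. a \<le> w \<and> w \<le> b}"

definition gen_filter :: "(nat \<Rightarrow> 'a set) \<Rightarrow> 'a filter" where
  "gen_filter I = (INF n. principal (I n))"

definition Jo :: "(mlf \<times> mlf) filter set" where
  "Jo = {\<U>. \<U> \<noteq> bot \<and> (\<exists>k::nat\<ge>1. \<exists>\<Sigma> :: nat \<Rightarrow> nat \<Rightarrow> mlf set.
      (\<forall>i<k. (\<forall>n. \<Sigma> i n \<noteq> {} \<and> (\<exists>a b. a \<in> ML0 Wt \<and> b \<in> ML0 Wt \<and> \<Sigma> i n = ointerval a b)) \<and>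
             decseq (\<Sigma> i) \<and>
             (\<forall>V. openin Wt V \<longrightarrow>
                 (\<exists>u\<in>ML0 Wt. (\<Inter>n. (\<lambda>w. restrict w V) ` \<Sigma> i n) = {restrict u V}) \<or>
                 (\<Inter>n. (\<lambda>w. restrict w V) ` \<Sigma> i n) = {})) \<and>
      \<U> \<le> (SUP i\<in>{..<k}. gen_filter (\<Sigma> i) \<times>\<^sub>F gen_filter (\<Sigma> i)))}"

definition JY :: "(xel \<times> xel) filter set" where
  "JY = {\<U>. (\<forall>j. filtermap (\<lambda>(a, b). (fst a j, fst b j)) \<U> \<in> Jo) \<and>
            filtermap (\<lambda>(a, b). (snd a, snd b)) \<U> \<in> Jo}"

definition Jl :: "((real^3 \<Rightarrow> real^3) \<times> (real^3 \<Rightarrow> real^3)) filter set" where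
  "Jl = {\<U>. \<U> \<noteq> bot \<and> (\<exists>k::nat\<ge>1. \<exists>us. (\<forall>i<k. us i \<in> Zset) \<and>
            \<U> \<le> (SUP i\<in>{..<k}. principal {us i} \<times>\<^sub>F principal {us i}))}"

definition JP :: "((xel \<times> (real^3 \<Rightarrow> real^3)) \<times> (xel \<times> (real^3 \<Rightarrow> real^3))) filter set" where
  "JP = {\<U>. filtermap (\<lambda>(a, b). (fst a, fst b)) \<U> \<in> JY \<and>
            filtermap (\<lambda>(a, b). (snd a, snd b)) \<U> \<in> Jl}"

definition JT0 :: "real \<Rightarrow> (xel set \<times> xel set) filter set" where
  "JT0 \<nu> = {\<U>. eventually (\<lambda>(c, d). c \<in> XT0 \<nu> \<and> d \<in> XT0 \<nu>) \<U> \<and>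
              filtermap (\<lambda>(c, d). (T0hat \<nu> c, T0hat \<nu> d)) \<U> \<in> JP}"

definition g_of :: "(pt \<Rightarrow> real^3) \<Rightarrow> xel" where
  "g_of f = ((\<lambda>j p. if p \<in> Om then ereal (f p $ j) else 0), (\<lambda>p. 0))"

end

theory Submission
  imports Defs
begin

text \<open>The operator T0 hat is injective and X carries the initial structure, so the extension to the
  completions is injective as soon as Cauchy equivalence on the range is transitive, and a point of
  the completed range is attained as soon as it is a limit of values of T0 hat.

  Transitivity: a Cauchy filter lies below a single convergent interval filter, and two such filters
  which meet can be merged. Convergence of the intervals [a n, b n] means that they leave no gap, that is,
  no nonempty open set on which all a n lie below r and all b n above s for some r < s.

  Density of the range: on an open dense union of small cells in t > 0 let the velocity be constant and
  the pressure affine with gradient f(c), where c is a point of the cell. Then T v = (f(c), 0) there,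
  which is close to (f, 0), and if the cells shrink fast enough as t tends to 0, the initial values are exact.\<close>

section \<open>Semicontinuous envelopes\<close>

text \<open>No equation is solved exactly: a point of the completion is a class of Cauchy filters,
  so a sequence of approximate solutions with uniformly shrinking residuals is enough. Cells are
  admissible because \<open>ML2_0\<close> asks for smoothness only off a closed nowhere dense set,
  so nothing has to match across cell walls. A constant velocity annihilates the time derivative,
  the convection, the viscosity and the divergence; the pressure gradient is free to supply the
  force. Two features of the spaces shape the rest. Cauchy filters on Z are principal, so the
  initial values may not be approximated but must equal u0. And \<open>ML0\<close> demands an open
  finite set, which regularization does not provide: a regularized function is lower
  semi-continuous, so the value minus infinity is taken on a closed set, but the value plus infinity
  need not be. When intervals are merged, a common lower end is therefore simply the minimum, while
  a common upper end has to be constructed.\<close>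

lemma nbhds_ofI: "openin W U \<Longrightarrow> x \<in> U \<Longrightarrow> U \<in> nbhds_of W x"
  by (auto simp: nbhds_of_def dest: openin_subset)

lemma lowerI_geI:
  assumes "openin W U" "x \<in> U" "\<And>y. y \<in> U \<Longrightarrow> c \<le> u y"
  shows "c \<le> lowerI W u x"
  unfolding lowerI_def
  by (rule order_trans[OF _ SUP_upper[OF nbhds_ofI[OF assms(1,2)]]]) (auto intro: INF_greatest assms(3))

lemma lowerI_gtD:
  assumes "c < lowerI W u x"
  obtains U where "openin W U" "x \<in> U" "\<And>y. y \<in> U \<Longrightarrow> c < u y"
proof -
  obtain V where "V \<in> nbhds_of W x" and V: "c < (INF y\<in>V. u y)"
    using assms unfolding lowerI_def less_SUP_iff by blast
  then obtain U where "openin W U" "x \<in> U" "U \<subseteq> V"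
    unfolding nbhds_of_def by blast
  with that V show thesis by (meson INF_lower less_le_trans subsetD)
qed

lemma upperS_leI:
  assumes "openin W U" "x \<in> U" "\<And>y. y \<in> U \<Longrightarrow> u y \<le> c"
  shows "upperS W u x \<le> c"
  unfolding upperS_def
  by (rule order_trans[OF INF_lower[OF nbhds_ofI[OF assms(1,2)]]]) (auto intro: SUP_least assms(3))

lemma upperS_lessD:
  assumes "upperS W u x < c"
  obtains U where "openin W U" "x \<in> U" "\<And>y. y \<in> U \<Longrightarrow> u y < c"
proof -
  obtain V where "V \<in> nbhds_of W x" and V: "(SUP y\<in>V. u y) < c"
    using assms unfolding upperS_def INF_less_iff by blast
  then obtain U where "openin W U" "x \<in> U" "U \<subseteq> V"
    unfolding nbhds_of_def by blast
  with that V show thesis by (meson SUP_upper le_less_trans subsetD)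
qed

lemma lowerI_le:
  assumes "x \<in> topspace W"
  shows "lowerI W u x \<le> u x"
  using lowerI_gtD[of "u x" W u x] by (metis not_le order.irrefl)

lemma upperS_ge:
  assumes "x \<in> topspace W"
  shows "u x \<le> upperS W u x"
  using upperS_lessD[of W u x "u x"] by (metis not_le order.irrefl)

lemma lowerI_mono_on:
  assumes V: "openin W V" "x \<in> V" and le: "\<And>y. y \<in> V \<Longrightarrow> u y \<le> v y"
  shows "lowerI W u x \<le> lowerI W v x"
proof (rule dense_le)
  fix c assume "c < lowerI W u x"
  then obtain U where U: "openin W U" "x \<in> U" "\<And>y. y \<in> U \<Longrightarrow> c < u y"
    by (rule lowerI_gtD) blast
  show "c \<le> lowerI W v x"
    by (rule lowerI_geI[of W "U \<inter> V"]) (use U V in \<open>auto, meson U(3) le less_imp_le order_trans\<close>)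
qed

lemma upperS_mono_on:
  assumes V: "openin W V" "x \<in> V" and le: "\<And>y. y \<in> V \<Longrightarrow> u y \<le> v y"
  shows "upperS W u x \<le> upperS W v x"
proof (rule dense_ge)
  fix c assume "upperS W v x < c"
  then obtain U where U: "openin W U" "x \<in> U" "\<And>y. y \<in> U \<Longrightarrow> v y < c"
    by (rule upperS_lessD) blast
  show "upperS W u x \<le> c"
    by (rule upperS_leI[of W "U \<inter> V"]) (use U V in \<open>auto, meson U(3) le less_imp_le order_trans\<close>)
qed

lemma lowerI_idem: "lowerI W (lowerI W u) x \<ge> lowerI W u x"
proof (rule dense_le)
  fix c assume "c < lowerI W u x"
  then obtain U where U: "openin W U" "x \<in> U" "\<And>y. y \<in> U \<Longrightarrow> c < u y"
    by (rule lowerI_gtD) blast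
  show "c \<le> lowerI W (lowerI W u) x"
    by (rule lowerI_geI[OF U(1,2)], rule lowerI_geI[OF U(1)]) (use U in \<open>auto intro: less_imp_le\<close>)
qed

lemma upperS_idem: "upperS W (upperS W u) x \<le> upperS W u x"
proof (rule dense_ge)
  fix c assume "upperS W u x < c"
  then obtain U where U: "openin W U" "x \<in> U" "\<And>y. y \<in> U \<Longrightarrow> u y < c"
    by (rule upperS_lessD) blast
  show "upperS W (upperS W u) x \<le> c"
    by (rule upperS_leI[OF U(1,2)], rule upperS_leI[OF U(1)]) (use U in \<open>auto intro: less_imp_le\<close>)
qed

lemma IS_eq: "x \<in> topspace W \<Longrightarrow> IS W u x = lowerI W (upperS W u) x"
  by (simp add: IS_def)

text \<open>From I S u \<le> S u follows S I S u \<le> S S u \<le> S u, hence one inequality; the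
  other is I S u \<le> I I S u \<le> I S I S u, using v \<le> S v.\<close>

lemma nlsc_IS: "nlsc W (IS W u)"
  unfolding nlsc_def
proof (intro ballI antisym)
  fix x assume x: "x \<in> topspace W"
  have le: "IS W u y \<le> upperS W u y" if "y \<in> topspace W" for y
    using that by (simp add: IS_eq lowerI_le)
  have "upperS W (IS W u) y \<le> upperS W u y" if "y \<in> topspace W" for y
    by (rule order_trans[OF upperS_mono_on[of W "topspace W" _ _ "upperS W u"] upperS_idem])
      (use that le in auto)
  then have "lowerI W (upperS W (IS W u)) x \<le> lowerI W (upperS W u) x"
    by (intro lowerI_mono_on[of W "topspace W"]) (use x in auto)
  then show "lowerI W (upperS W (IS W u)) x \<le> IS W u x"
    using x by (simp add: IS_eq)
  have "IS W u x \<le> lowerI W (lowerI W (upperS W u)) x"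
    using x by (simp add: IS_eq lowerI_idem)
  also have "\<dots> \<le> lowerI W (upperS W (IS W u)) x"
    by (rule lowerI_mono_on[of W "topspace W"]) (use x upperS_ge[of _ W "IS W u"] in \<open>auto simp: IS_eq\<close>)
  finally show "IS W u x \<le> lowerI W (upperS W (IS W u)) x" .
qed

text \<open>If S v < c at a point of V, then v < c on a neighbourhood, and D meets that
  neighbourhood in an open set where u \<le> v < c. Openness of D turns this into S u \<le> c at a
  point z of D, so S u cannot stay above c near x. Values off an open dense set are thus irrelevant
  after regularization.\<close>

lemma IS_le_on_dense:
  assumes D: "openin W D" "W closure_of D = topspace W" and V: "openin W V" "x \<in> V"
    and le: "\<And>y. y \<in> V \<Longrightarrow> y \<in> D \<Longrightarrow> u y \<le> v y"
  shows "IS W u x \<le> IS W v x"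
proof -
  have xW: "x \<in> topspace W" using V openin_subset by blast
  have "lowerI W (upperS W u) x \<le> lowerI W (upperS W v) x"
  proof (rule dense_le)
    fix c assume "c < lowerI W (upperS W u) x"
    then obtain U where U: "openin W U" "x \<in> U" "\<And>y. y \<in> U \<Longrightarrow> c < upperS W u y"
      by (rule lowerI_gtD) blast
    show "c \<le> lowerI W (upperS W v) x"
    proof (rule lowerI_geI[of W "U \<inter> V"])
      fix y assume y: "y \<in> U \<inter> V"
      show "c \<le> upperS W v y"
      proof (rule ccontr)
        assume "\<not> c \<le> upperS W v y"
        then have "upperS W v y < c" by simp
        then obtain N where N: "openin W N" "y \<in> N" "\<And>z. z \<in> N \<Longrightarrow> v z < c"
          by (rule upperS_lessD) blast
        have open1: "openin W (N \<inter> (U \<inter> V))" using N U V by blast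
        then obtain z where z: "z \<in> D" "z \<in> N \<inter> (U \<inter> V)"
          using D(2) N(2) y dense_intersects_open by (metis IntI disjoint_iff empty_iff)
        have "upperS W u z \<le> c"
        proof (rule upperS_leI[of W "D \<inter> (N \<inter> (U \<inter> V))"])
          show "openin W (D \<inter> (N \<inter> (U \<inter> V)))" using open1 D(1) by blast
          show "z \<in> D \<inter> (N \<inter> (U \<inter> V))" using z by blast
          fix y assume "y \<in> D \<inter> (N \<inter> (U \<inter> V))"
          then show "u y \<le> c" using le[of y] N(3)[of y] by (meson IntD1 IntD2 le_less_trans less_imp_le)
        qed
        then show False using U(3)[of z] z by (auto simp: not_le)
      qed
    qed (use U V in auto)
  qed
  then show ?thesis using xW by (simp add: IS_eq)
qed

lemma IS_mono_on:
  assumes "openin W V" "x \<in> V" "\<And>y. y \<in> V \<Longrightarrow> u y \<le> v y"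
  shows "IS W u x \<le> IS W v x"
  by (rule IS_le_on_dense[of W "topspace W"]) (use assms in \<open>auto simp: closure_of_topspace\<close>)

lemma IS_const_le:
  assumes "openin W V" "x \<in> V" "\<And>y. y \<in> V \<Longrightarrow> u y \<le> c"
  shows "IS W u x \<le> c"
proof -
  have xW: "x \<in> topspace W" using assms openin_subset by blast
  have "lowerI W (upperS W u) x \<le> upperS W u x" by (rule lowerI_le[OF xW])
  also have "\<dots> \<le> c" by (rule upperS_leI[OF assms])
  finally show ?thesis using xW by (simp add: IS_eq)
qed

lemma lowerI_le_IS:
  assumes "x \<in> topspace W"
  shows "lowerI W u x \<le> IS W u x"
  unfolding IS_eq[OF assms]
  by (rule lowerI_mono_on[of W "topspace W"]) (use assms upperS_ge[of _ W u] in auto)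

lemma IS_ge_const:
  assumes "openin W V" "x \<in> V" "\<And>y. y \<in> V \<Longrightarrow> c \<le> u y"
  shows "c \<le> IS W u x"
proof -
  have xW: "x \<in> topspace W" using assms openin_subset by blast
  show ?thesis using lowerI_geI[OF assms] lowerI_le_IS[OF xW, of u] by (meson order_trans)
qed

lemma IS_nlsc: "nlsc W u \<Longrightarrow> x \<in> topspace W \<Longrightarrow> IS W u x = u x"
  by (simp add: nlsc_def IS_eq)

lemma IS_cong_on:
  assumes "openin W V" "x \<in> V" "\<And>y. y \<in> V \<Longrightarrow> u y = v y"
  shows "IS W u x = IS W v x"
  by (intro antisym IS_mono_on[OF assms(1,2)]) (use assms in auto)

text \<open>Finiteness and continuity at the points of an open set, phrased through the envelopes;
  the opposite inequalities I u \<le> u \<le> S u always hold on the space. In this form u can be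
  compared with \<open>IS W u\<close> directly, without \<open>real_of_ereal\<close> and without a
  subspace topology.\<close>

definition regular_on :: "'a topology \<Rightarrow> 'a set \<Rightarrow> ('a \<Rightarrow> ereal) \<Rightarrow> bool" where
  "regular_on W D u \<longleftrightarrow> openin W D \<and>
     (\<forall>x\<in>D. \<bar>u x\<bar> \<noteq> \<infinity> \<and> u x \<le> lowerI W u x \<and> upperS W u x \<le> u x)"

text \<open>Continuity of the real part speaks about real thresholds only; a real number strictly
  between c and \<open>u x\<close> reduces extended thresholds to these.\<close>

lemma regular_onI:
  assumes "openin W D" and fin: "\<And>x. x \<in> D \<Longrightarrow> \<bar>u x\<bar> \<noteq> \<infinity>"
    and cont: "continuous_map (subtopology W D) euclideanreal (\<lambda>x. real_of_ereal (u x))"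
  shows "regular_on W D u"
  unfolding regular_on_def
proof (intro conjI ballI)
  fix x assume x: "x \<in> D"
  let ?h = "\<lambda>x. real_of_ereal (u x)"
  have u: "u y = ereal (?h y)" if "y \<in> D" for y
    using fin[OF that] by (simp add: ereal_real)
  have top: "topspace (subtopology W D) = D"
    using openin_subset[OF assms(1)] by auto
  have gt: "openin W {y \<in> D. ?h y > a}" and lt: "openin W {y \<in> D. ?h y < a}" for a
    using cont unfolding continuous_map_upper_lower_semicontinuous_lt top openin_open_subtopology[OF assms(1)]
    by blast+
  show "u x \<le> lowerI W u x"
  proof (rule dense_le)
    fix c assume c: "c < u x"
    then obtain r where r: "c < ereal r" "ereal r < u x"
      using ereal_dense2[OF c] by blast
    then have "x \<in> {y \<in> D. ?h y > r}" using x u[OF x] by (metis less_ereal.simps(1) mem_Collect_eq)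
    then show "c \<le> lowerI W u x"
    proof (rule lowerI_geI[OF gt[of r]])
      fix y assume "y \<in> {y \<in> D. ?h y > r}"
      then have "ereal r < u y" using u[of y] by (metis (no_types, lifting) less_ereal.simps(1) mem_Collect_eq)
      then show "c \<le> u y" using r(1) by simp
    qed
  qed
  show "upperS W u x \<le> u x"
  proof (rule dense_ge)
    fix c assume c: "u x < c"
    then obtain r where r: "u x < ereal r" "ereal r < c"
      using ereal_dense2[OF c] by blast
    then have "x \<in> {y \<in> D. ?h y < r}" using x u[OF x] by (metis less_ereal.simps(1) mem_Collect_eq)
    then show "upperS W u x \<le> c"
    proof (rule upperS_leI[OF lt[of r]])
      fix y assume "y \<in> {y \<in> D. ?h y < r}"
      then have "u y < ereal r" using u[of y] by (metis (no_types, lifting) less_ereal.simps(1) mem_Collect_eq)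
      then show "u y \<le> c" using r(2) by simp
    qed
  qed
qed (use assms in auto)

lemma regular_on_open: "regular_on W D u \<Longrightarrow> openin W D"
  by (simp add: regular_on_def)

lemma regular_on_finite: "regular_on W D u \<Longrightarrow> x \<in> D \<Longrightarrow> \<bar>u x\<bar> \<noteq> \<infinity>"
  by (simp add: regular_on_def)

lemma regular_on_subset: "regular_on W D u \<Longrightarrow> openin W E \<Longrightarrow> E \<subseteq> D \<Longrightarrow> regular_on W E u"
  unfolding regular_on_def by (meson subsetD)

lemma regular_on_gt:
  assumes "regular_on W D u" "x \<in> D" "c < u x"
  shows "\<exists>U. openin W U \<and> x \<in> U \<and> (\<forall>y\<in>U. c < u y)"
proof -
  have "c < lowerI W u x" using assms unfolding regular_on_def by (metis less_le_trans)
  then show ?thesis by (rule lowerI_gtD) blast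
qed

lemma regular_on_lt:
  assumes "regular_on W D u" "x \<in> D" "u x < c"
  shows "\<exists>U. openin W U \<and> x \<in> U \<and> (\<forall>y\<in>U. u y < c)"
proof -
  have "upperS W u x < c" using assms unfolding regular_on_def by (metis le_less_trans)
  then show ?thesis by (rule upperS_lessD) blast
qed

lemma regular_on_cong:
  assumes "regular_on W D u" and eq: "\<And>x. x \<in> D \<Longrightarrow> u x = v x"
  shows "regular_on W D v"
  unfolding regular_on_def
proof (intro conjI ballI)
  fix x assume x: "x \<in> D"
  note D = regular_on_open[OF assms(1)]
  show "\<bar>v x\<bar> \<noteq> \<infinity>" using regular_on_finite[OF assms(1) x] eq x by simp
  have "lowerI W u x \<le> lowerI W v x" "upperS W v x \<le> upperS W u x"
    by (rule lowerI_mono_on[OF D x] upperS_mono_on[OF D x]; simp add: eq)+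
  then show "v x \<le> lowerI W v x" "upperS W v x \<le> v x"
    using assms(1) x eq[OF x] unfolding regular_on_def by (metis order_trans)+
qed (rule regular_on_open[OF assms(1)])

text \<open>On the whole space I u \<le> I S u \<le> S u, and at a regular point the outer terms
  equal u.\<close>

lemma IS_regular:
  assumes "regular_on W D u" "x \<in> D"
  shows "IS W u x = u x"
proof -
  have xW: "x \<in> topspace W" using assms regular_on_open openin_subset by blast
  have "u x \<le> IS W u x"
    using lowerI_le_IS[OF xW, of u] assms unfolding regular_on_def by (meson order_trans)
  moreover have "IS W u x \<le> upperS W u x"
    unfolding IS_eq[OF xW] by (rule lowerI_le[OF xW])
  ultimately show ?thesis using assms unfolding regular_on_def by (meson order_trans antisym)
qed

lemma regular_on_IS: "regular_on W D u \<Longrightarrow> regular_on W D (IS W u)"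
  by (rule regular_on_cong) (auto simp: IS_regular)

lemma regular_on_const: "openin W D \<Longrightarrow> regular_on W D (\<lambda>x. ereal c)"
  by (rule regular_onI) auto

lemma regular_on_Un:
  assumes "regular_on W D u" "regular_on W E u"
  shows "regular_on W (D \<union> E) u"
  using assms unfolding regular_on_def by (simp add: openin_Un ball_Un)

lemma regular_on_max:
  assumes "regular_on W D u" "regular_on W D v"
  shows "regular_on W D (\<lambda>x. max (u x) (v x))"
  unfolding regular_on_def
proof (intro conjI ballI)
  fix x assume x: "x \<in> D"
  show "\<bar>max (u x) (v x)\<bar> \<noteq> \<infinity>"
    using regular_on_finite[OF assms(1) x] regular_on_finite[OF assms(2) x] by (simp add: max_def)
  show "max (u x) (v x) \<le> lowerI W (\<lambda>x. max (u x) (v x)) x"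
  proof (rule dense_le)
    fix c assume "c < max (u x) (v x)"
    then have "c < u x \<or> c < v x" by (simp add: less_max_iff_disj)
    then obtain U where "openin W U" "x \<in> U" "\<And>y. y \<in> U \<Longrightarrow> c < u y \<or> c < v y"
      using regular_on_gt[OF assms(1) x, of c] regular_on_gt[OF assms(2) x, of c] by blast
    then show "c \<le> lowerI W (\<lambda>x. max (u x) (v x)) x"
      by (intro lowerI_geI[of W U]) (auto simp: le_max_iff_disj intro: less_imp_le)
  qed
  show "upperS W (\<lambda>x. max (u x) (v x)) x \<le> max (u x) (v x)"
  proof (rule dense_ge)
    fix c assume "max (u x) (v x) < c"
    then have "u x < c" "v x < c" by auto
    obtain U where "openin W U" "x \<in> U" "\<And>y. y \<in> U \<Longrightarrow> u y < c"
      using regular_on_lt[OF assms(1) x \<open>u x < c\<close>] by blast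
    moreover obtain V where "openin W V" "x \<in> V" "\<And>y. y \<in> V \<Longrightarrow> v y < c"
      using regular_on_lt[OF assms(2) x \<open>v x < c\<close>] by blast
    ultimately show "upperS W (\<lambda>x. max (u x) (v x)) x \<le> c"
      by (intro upperS_leI[of W "U \<inter> V"]) (auto intro: less_imp_le)
  qed
qed (rule regular_on_open[OF assms(1)])

lemma regular_on_min:
  assumes "regular_on W D u" "regular_on W D v"
  shows "regular_on W D (\<lambda>x. min (u x) (v x))"
  unfolding regular_on_def
proof (intro conjI ballI)
  fix x assume x: "x \<in> D"
  show "\<bar>min (u x) (v x)\<bar> \<noteq> \<infinity>"
    using regular_on_finite[OF assms(1) x] regular_on_finite[OF assms(2) x] by (simp add: min_def)
  show "upperS W (\<lambda>x. min (u x) (v x)) x \<le> min (u x) (v x)"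
  proof (rule dense_ge)
    fix c assume "min (u x) (v x) < c"
    then have "u x < c \<or> v x < c" by (simp add: min_less_iff_disj)
    then obtain U where "openin W U" "x \<in> U" "\<And>y. y \<in> U \<Longrightarrow> u y < c \<or> v y < c"
      using regular_on_lt[OF assms(1) x, of c] regular_on_lt[OF assms(2) x, of c] by blast
    then show "upperS W (\<lambda>x. min (u x) (v x)) x \<le> c"
      by (intro upperS_leI[of W U]) (auto simp: min_le_iff_disj intro: less_imp_le)
  qed
  show "min (u x) (v x) \<le> lowerI W (\<lambda>x. min (u x) (v x)) x"
  proof (rule dense_le)
    fix c assume "c < min (u x) (v x)"
    then have "c < u x" "c < v x" by auto
    obtain U where "openin W U" "x \<in> U" "\<And>y. y \<in> U \<Longrightarrow> c < u y"
      using regular_on_gt[OF assms(1) x \<open>c < u x\<close>] by blast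
    moreover obtain V where "openin W V" "x \<in> V" "\<And>y. y \<in> V \<Longrightarrow> c < v y"
      using regular_on_gt[OF assms(2) x \<open>c < v x\<close>] by blast
    ultimately show "c \<le> lowerI W (\<lambda>x. min (u x) (v x)) x"
      by (intro lowerI_geI[of W "U \<inter> V"]) (auto intro: less_imp_le)
  qed
qed (rule regular_on_open[OF assms(1)])

section \<open>Open dense sets and membership in \<open>ML0\<close>\<close>

lemma dense_inter:
  assumes "openin W D" "W closure_of D = topspace W" "W closure_of E = topspace W"
  shows "W closure_of (D \<inter> E) = topspace W"
  unfolding dense_intersects_open
proof (intro allI impI)
  fix T assume T: "openin W T \<and> T \<noteq> {}"
  then have "openin W (D \<inter> T)" "D \<inter> T \<noteq> {}"
    using assms(1,2) unfolding dense_intersects_open by blast+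
  then show "D \<inter> E \<inter> T \<noteq> {}"
    using assms(3) unfolding dense_intersects_open by (metis Int_assoc Int_commute)
qed

lemma closed_nowhere_dense_Diff:
  assumes "openin W D" "W closure_of D = topspace W"
  shows "closed_nowhere_dense W (topspace W - D)"
  unfolding closed_nowhere_dense_def
  using assms by (simp add: closedin_diff interior_of_complement)

lemma closed_nowhere_denseD:
  assumes "closed_nowhere_dense W G"
  shows "openin W (topspace W - G)" "W closure_of (topspace W - G) = topspace W"
  using assms unfolding closed_nowhere_dense_def by (auto simp: closure_of_complement)

lemma ML0_regular:
  assumes "u \<in> ML0 W"
  obtains D where "W closure_of D = topspace W" "regular_on W D u"
proof -
  obtain G where G: "closed_nowhere_dense W G" "\<forall>x\<in>topspace W - G. \<bar>u x\<bar> \<noteq> \<infinity>"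
    "continuous_map (subtopology W (topspace W - G)) euclideanreal (\<lambda>x. real_of_ereal (u x))"
    using assms unfolding ML0_def by blast
  show thesis
    by (rule that[of "topspace W - G"], rule closed_nowhere_denseD[OF G(1)])
      (rule regular_onI, use closed_nowhere_denseD[OF G(1)] G in auto)
qed

lemma ML0_outside: "u \<in> ML0 W \<Longrightarrow> x \<notin> topspace W \<Longrightarrow> u x = 0"
  by (simp add: ML0_def)

lemma ML0_IS:
  assumes "u \<in> ML0 W"
  shows "IS W u x = u x"
  using assms by (cases "x \<in> topspace W") (auto simp: ML0_def IS_nlsc, simp add: IS_def)

lemma ML0_finite_set:
  assumes "u \<in> ML0 W"
  shows "openin W {x \<in> topspace W. \<bar>u x\<bar> \<noteq> \<infinity>}" "W closure_of {x \<in> topspace W. \<bar>u x\<bar> \<noteq> \<infinity>} = topspace W"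
  using assms by (auto simp: ML0_def nearly_finite_def)

text \<open>Normality comes from idempotence; continuity off a nowhere dense set and density of the
  finite set come from D. Openness of the finite set remains as a hypothesis, because the
  regularized function may take the value plus infinity on a set that is not closed. Each
  application has to determine the finite set itself.\<close>

lemma IS_in_ML0:
  assumes D: "W closure_of D = topspace W" and reg: "regular_on W D u"
    and fin: "openin W {x \<in> topspace W. \<bar>IS W u x\<bar> \<noteq> \<infinity>}"
  shows "IS W u \<in> ML0 W"
proof -
  note oD = regular_on_open[OF reg]
  note DW = openin_subset[OF oD]
  note reg' = regular_on_IS[OF reg]
  let ?u = "IS W u"
  have "D \<subseteq> {x \<in> topspace W. \<bar>?u x\<bar> \<noteq> \<infinity>}"
    by (intro subsetI CollectI conjI; erule subsetD[OF DW] regular_on_finite[OF reg'])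
  then have "W closure_of {x \<in> topspace W. \<bar>?u x\<bar> \<noteq> \<infinity>} = topspace W"
    using closure_of_mono[of D "{x \<in> topspace W. \<bar>?u x\<bar> \<noteq> \<infinity>}" W] D
    by (simp only: subset_antisym closure_of_subset_topspace)
  moreover have "continuous_map (subtopology W D) euclideanreal (\<lambda>x. real_of_ereal (?u x))"
    (is "continuous_map _ _ ?h")
    unfolding continuous_map_upper_lower_semicontinuous_lt
  proof (intro conjI allI)
    fix a :: real
    have gt: "a < ?h y \<longleftrightarrow> ereal a < ?u y" and lt: "?h y < a \<longleftrightarrow> ?u y < ereal a" if y: "y \<in> D" for y
    proof -
      obtain r where "?u y = ereal r"
        using regular_on_finite[OF reg' y] by (cases "?u y") simp_all
      then show "a < ?h y \<longleftrightarrow> ereal a < ?u y" "?h y < a \<longleftrightarrow> ?u y < ereal a" by simp_all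
    qed
    have "openin W {x \<in> D. ereal a < ?u x}"
      unfolding openin_subopen[of _ "{x \<in> D. ereal a < ?u x}"]
    proof
      fix x assume x: "x \<in> {x \<in> D. ereal a < ?u x}"
      then obtain U where "openin W U" "x \<in> U" "\<And>y. y \<in> U \<Longrightarrow> ereal a < ?u y"
        using regular_on_gt[OF reg', of x "ereal a"] by blast
      then show "\<exists>T. openin W T \<and> x \<in> T \<and> T \<subseteq> {x \<in> D. ereal a < ?u x}"
        using oD x by (intro exI[of _ "U \<inter> D"] conjI openin_Int) (simp_all add: subset_iff)
    qed
    moreover have "openin W {x \<in> D. ?u x < ereal a}"
      unfolding openin_subopen[of _ "{x \<in> D. ?u x < ereal a}"]
    proof
      fix x assume x: "x \<in> {x \<in> D. ?u x < ereal a}"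
      then obtain U where "openin W U" "x \<in> U" "\<And>y. y \<in> U \<Longrightarrow> ?u y < ereal a"
        using regular_on_lt[OF reg', of x "ereal a"] by blast
      then show "\<exists>T. openin W T \<and> x \<in> T \<and> T \<subseteq> {x \<in> D. ?u x < ereal a}"
        using oD x by (intro exI[of _ "U \<inter> D"] conjI openin_Int) (simp_all add: subset_iff)
    qed
    moreover have "{x \<in> topspace (subtopology W D). a < ?h x} = {x \<in> D. ereal a < ?u x}"
      "{x \<in> topspace (subtopology W D). ?h x < a} = {x \<in> D. ?u x < ereal a}"
      using DW gt lt by (auto simp only: topspace_subtopology)
    ultimately have "openin W {x \<in> topspace (subtopology W D). a < ?h x}"
      "openin W {x \<in> topspace (subtopology W D). ?h x < a}"
      by (simp_all only:)
    then show "openin (subtopology W D) {x \<in> topspace (subtopology W D). a < ?h x}"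
      "openin (subtopology W D) {x \<in> topspace (subtopology W D). ?h x < a}"
      by (intro openin_open_subtopology[OF oD, THEN iffD2] conjI; force)+
  qed
  moreover have "topspace W - (topspace W - D) = D" using DW by blast
  moreover note nlsc_IS[of W u] fin closed_nowhere_dense_Diff[OF oD D] regular_on_finite[OF reg']
  moreover have "IS W u x = 0" if "x \<notin> topspace W" for x using that by (simp add: IS_def)
  ultimately show ?thesis
    unfolding ML0_def nearly_finite_def mem_Collect_eq by metis
qed

lemma regular_in_ML0:
  assumes "regular_on W (topspace W) u" "\<And>x. x \<notin> topspace W \<Longrightarrow> u x = 0"
  shows "u \<in> ML0 W"
proof -
  have eq: "IS W u = u"
    using IS_regular[OF assms(1)] assms(2) by (auto simp: IS_def)
  have "{x \<in> topspace W. \<bar>IS W u x\<bar> \<noteq> \<infinity>} = topspace W"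
    unfolding eq
    by (rule set_eqI, unfold mem_Collect_eq, rule iffI)
      (erule conjunct1, rule conjI, assumption, erule regular_on_finite[OF assms(1)])
  then have "IS W u \<in> ML0 W"
    by (intro IS_in_ML0[OF closure_of_topspace assms(1)]) (simp only: openin_topspace)
  then show ?thesis by (simp only: eq)
qed

lemma ML0_le_on_dense:
  assumes "u \<in> ML0 W" "v \<in> ML0 W" "openin W D" "W closure_of D = topspace W" "openin W V" "x \<in> V"
    "\<And>y. y \<in> V \<Longrightarrow> y \<in> D \<Longrightarrow> u y \<le> v y"
  shows "u x \<le> v x"
  using IS_le_on_dense[where u = u and v = v, OF assms(3-6)] assms(7) ML0_IS[OF assms(1)] ML0_IS[OF assms(2)] by simp

lemma ML0_lsc:
  assumes "u \<in> ML0 W" "x \<in> topspace W" "c < u x"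
  shows "\<exists>U. openin W U \<and> x \<in> U \<and> (\<forall>y\<in>U. c < u y)"
proof -
  have "c < lowerI W (upperS W u) x"
    using assms ML0_IS[OF assms(1), of x] by (simp add: IS_eq)
  then have "c < lowerI W (lowerI W (upperS W u)) x"
    by (rule less_le_trans[OF _ lowerI_idem])
  then obtain U where U: "openin W U" "x \<in> U" "\<And>y. y \<in> U \<Longrightarrow> c < lowerI W (upperS W u) y"
    by (rule lowerI_gtD) blast
  show ?thesis
  proof (intro exI[of _ U] conjI ballI U(1,2))
    fix y assume y: "y \<in> U"
    then have "y \<in> topspace W" using U(1) openin_subset by blast
    then show "c < u y" using U(3)[OF y] ML0_IS[OF assms(1), of y] by (simp add: IS_eq)
  qed
qed

text \<open>The minimum is lower semi-continuous, and its regularization lies below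
  \<open>IS W u = u\<close> and \<open>IS W v = v\<close>, so it is normal. Near a point where it is
  finite, both functions exceed minus infinity by lower semi-continuity and at least one of them is
  finite, so the finite set is open.\<close>

lemma min_in_ML0:
  assumes u: "u \<in> ML0 W" and v: "v \<in> ML0 W"
  shows "(\<lambda>x. min (u x) (v x)) \<in> ML0 W"
proof -
  let ?m = "\<lambda>x. min (u x) (v x)"
  have eq: "IS W ?m = ?m"
  proof
    fix x
    show "IS W ?m x = ?m x"
    proof (cases "x \<in> topspace W")
      case True
      have "IS W ?m x \<le> IS W u x" "IS W ?m x \<le> IS W v x"
        by (rule IS_mono_on[of W "topspace W"]; use True in auto)+
      then have "IS W ?m x \<le> ?m x" by (simp add: ML0_IS u v)
      moreover have "?m x \<le> IS W ?m x"
      proof (rule dense_le)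
        fix c assume "c < ?m x"
        then have "c < u x" "c < v x" by auto
        obtain U where "openin W U" "x \<in> U" "\<And>y. y \<in> U \<Longrightarrow> c < u y"
          using ML0_lsc[OF u True \<open>c < u x\<close>] by blast
        moreover obtain V where "openin W V" "x \<in> V" "\<And>y. y \<in> V \<Longrightarrow> c < v y"
          using ML0_lsc[OF v True \<open>c < v x\<close>] by blast
        ultimately show "c \<le> IS W ?m x"
          by (intro IS_ge_const[of W "U \<inter> V"]) (auto intro: less_imp_le)
      qed
      ultimately show ?thesis by (rule antisym)
    next
      case False
      then show ?thesis using ML0_outside[OF u] ML0_outside[OF v] by (simp add: IS_def)
    qed
  qed
  obtain D where D: "W closure_of D = topspace W" "regular_on W D u" by (rule ML0_regular[OF u])
  obtain E where E: "W closure_of E = topspace W" "regular_on W E v" by (rule ML0_regular[OF v])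
  have oDE: "openin W (D \<inter> E)" using D E regular_on_open by blast
  have reg: "regular_on W (D \<inter> E) ?m"
    by (rule regular_on_min) (use D E oDE regular_on_subset in blast)+
  have "openin W {x \<in> topspace W. \<bar>?m x\<bar> \<noteq> \<infinity>}" (is "openin W ?F")
    unfolding openin_subopen[of _ ?F]
  proof
    fix x assume x: "x \<in> ?F"
    let ?A = "{x \<in> topspace W. \<bar>u x\<bar> \<noteq> \<infinity>}" and ?B = "{x \<in> topspace W. \<bar>v x\<bar> \<noteq> \<infinity>}"
    have "- \<infinity> < u x" "- \<infinity> < v x" using x by (auto simp: min_def split: if_splits)
    have xW: "x \<in> topspace W" using x by simp
    obtain U where U: "openin W U" "x \<in> U" "\<And>y. y \<in> U \<Longrightarrow> - \<infinity> < u y"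
      using ML0_lsc[OF u xW \<open>- \<infinity> < u x\<close>] by blast
    obtain V where V: "openin W V" "x \<in> V" "\<And>y. y \<in> V \<Longrightarrow> - \<infinity> < v y"
      using ML0_lsc[OF v xW \<open>- \<infinity> < v x\<close>] by blast
    have AB: "x \<in> ?A \<or> x \<in> ?B" using x by (auto simp: min_def split: if_splits)
    have "openin W (U \<inter> V \<inter> (?A \<union> ?B))"
      by (intro openin_Int openin_Un U V ML0_finite_set(1) u v)
    moreover have "U \<inter> V \<inter> (?A \<union> ?B) \<subseteq> ?F"
    proof
      fix y assume y: "y \<in> U \<inter> V \<inter> (?A \<union> ?B)"
      then have "- \<infinity> < u y" "- \<infinity> < v y" "y \<in> ?A \<union> ?B" using U V by auto
      then show "y \<in> ?F" by (auto simp: min_def)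
    qed
    moreover have "x \<in> U \<inter> V \<inter> (?A \<union> ?B)"
      using U(2) V(2) AB by (simp only: Int_iff Un_iff simp_thms)
    ultimately show "\<exists>T. openin W T \<and> x \<in> T \<and> T \<subseteq> ?F" by (intro exI conjI)
  qed
  then have "IS W ?m \<in> ML0 W"
    by (intro IS_in_ML0[OF dense_inter[OF regular_on_open[OF D(2)] D(1) E(1)] reg]) (simp only: eq)
  then show ?thesis by (simp only: eq)
qed

text \<open>Raise a to the constant c on V2 and regularize. Off the closure of V2 nothing has
  changed, and on V1 the result is caught between a and c; since the closure lies in V1, these two
  open regions cover the space and show that the finite set is open. The last clause is what later
  places w below a given upper end b.\<close>

lemma ML0_patch:
  fixes c :: real
  assumes a: "a \<in> ML0 W" and V1: "openin W V1" and fin: "\<And>x. x \<in> V1 \<Longrightarrow> \<bar>a x\<bar> \<noteq> \<infinity>"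
    and le: "\<And>x. x \<in> V1 \<Longrightarrow> a x \<le> ereal c"
    and V2: "openin W V2" "W closure_of V2 \<subseteq> V1"
  shows "\<exists>w\<in>ML0 W. a \<le> w \<and> (\<forall>x\<in>V2. w x = ereal c) \<and>
    (\<forall>b\<in>ML0 W. a \<le> b \<longrightarrow> (\<forall>x\<in>V2. ereal c \<le> b x) \<longrightarrow> w \<le> b)"
proof -
  define w where "w = (\<lambda>x. if x \<in> V2 then ereal c else a x)"
  let ?K = "W closure_of V2"
  have V2K: "V2 \<subseteq> ?K" using V2(1) by (simp add: closure_of_subset openin_subset)
  have V2V1: "V2 \<subseteq> V1" using V2K V2(2) by (rule subset_trans)
  have oK: "openin W (topspace W - ?K)" by (simp add: openin_diff)
  obtain D where D: "W closure_of D = topspace W" "regular_on W D a" by (rule ML0_regular[OF a])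
  note oD = regular_on_open[OF D(2)]
  have oDK: "openin W (D - ?K)" using oD by (simp add: openin_diff)
  have reg1: "regular_on W V2 w"
    by (rule regular_on_cong[OF regular_on_const[OF V2(1)]]) (simp add: w_def)
  have reg2: "regular_on W (D - ?K) w"
    by (rule regular_on_cong[OF regular_on_subset[OF D(2) oDK Diff_subset]]) (use V2K in \<open>auto simp: w_def\<close>)
  have dense: "W closure_of (V2 \<union> (D - ?K)) = topspace W"
    unfolding dense_intersects_open
  proof (intro allI impI)
    fix T assume T: "openin W T \<and> T \<noteq> {}"
    show "(V2 \<union> (D - ?K)) \<inter> T \<noteq> {}"
    proof (cases "V2 \<inter> T = {}")
      case True
      then have "?K \<inter> T = {}" using T by (metis inf_commute openin_Int_closure_of_eq_empty)
      moreover have "D \<inter> T \<noteq> {}" using D(1) T unfolding dense_intersects_open by blast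
      ultimately show ?thesis by blast
    qed blast
  qed
  have w_ge: "a x \<le> w x" for x using le V2V1 by (auto simp: w_def)
  have a_le: "a x \<le> IS W w x" if "x \<in> topspace W" for x
    using IS_mono_on[of W "topspace W" x a w] w_ge that ML0_IS[OF a, of x] by simp
  have le_c: "IS W w x \<le> ereal c" if "x \<in> V1" for x
    by (rule IS_const_le[OF V1 that]) (use le in \<open>auto simp: w_def\<close>)
  have far: "IS W w x = a x" if "x \<in> topspace W" "x \<notin> ?K" for x
  proof -
    have "IS W w x = IS W a x"
      by (rule IS_cong_on[OF oK]) (use that V2K in \<open>auto simp: w_def\<close>)
    then show ?thesis by (simp only: ML0_IS[OF a])
  qed
  have finV1: "\<bar>IS W w x\<bar> \<noteq> \<infinity>" if "x \<in> V1" for x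
    using a_le[of x] le_c[OF that] fin[OF that] that openin_subset[OF V1]
    by (cases "a x"; cases "IS W w x") (auto simp: subset_iff)
  have "{x \<in> topspace W. \<bar>IS W w x\<bar> \<noteq> \<infinity>} = V1 \<union> ({x \<in> topspace W. \<bar>a x\<bar> \<noteq> \<infinity>} \<inter> (topspace W - ?K))"
    (is "?L = ?R")
  proof (rule set_eqI)
    fix x
    consider "x \<in> V1" "x \<in> topspace W" | "x \<notin> V1" "x \<in> topspace W" "x \<notin> ?K" | "x \<notin> topspace W" "x \<notin> V1"
      using V2(2) openin_subset[OF V1] by blast
    then show "x \<in> ?L \<longleftrightarrow> x \<in> ?R"
      by cases (use finV1 far in simp_all)
  qed
  then have "openin W ?L"
    using V1 oK ML0_finite_set(1)[OF a] by (simp only: openin_Un openin_Int)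
  then have "IS W w \<in> ML0 W"
    by (rule IS_in_ML0[OF dense regular_on_Un[OF reg1 reg2]])
  moreover have "a \<le> IS W w"
  proof (rule le_funI)
    fix x show "a x \<le> IS W w x"
      using a_le[of x] ML0_outside[OF a, of x] by (cases "x \<in> topspace W") (simp_all add: IS_def)
  qed
  moreover have "IS W w x = ereal c" if "x \<in> V2" for x
    using IS_regular[OF reg1 that] that by (simp add: w_def)
  moreover have "IS W w \<le> b" if b: "b \<in> ML0 W" "a \<le> b" "\<forall>x\<in>V2. ereal c \<le> b x" for b
  proof (rule le_funI)
    fix x
    have "IS W w x \<le> IS W b x" if "x \<in> topspace W"
      by (rule IS_mono_on[OF openin_topspace that]) (use b(2,3) in \<open>auto simp: w_def le_fun_def\<close>)
    then show "IS W w x \<le> b x"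
      using ML0_IS[OF b(1), of x] ML0_outside[OF b(1), of x] by (cases "x \<in> topspace W") (simp_all add: IS_def)
  qed
  ultimately show ?thesis by blast
qed

text \<open>The strict inequality at x may sit at a point of discontinuity. By density it also
  occurs at a common regular point y of V, and continuity at y leaves room for two reals on a whole
  neighbourhood.\<close>

lemma ML0_less_gap:
  assumes u: "u \<in> ML0 W" and v: "v \<in> ML0 W" and V: "openin W V" "x \<in> V" and less: "u x < v x"
  obtains V' r s where "openin W V'" "V' \<noteq> {}" "V' \<subseteq> V" "r < s"
    "\<And>y. y \<in> V' \<Longrightarrow> u y \<le> ereal r \<and> ereal s \<le> v y"
proof -
  obtain D where D: "W closure_of D = topspace W" "regular_on W D u" by (rule ML0_regular[OF u])
  obtain E where E: "W closure_of E = topspace W" "regular_on W E v" by (rule ML0_regular[OF v])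
  note oD = regular_on_open[OF D(2)] and oE = regular_on_open[OF E(2)]
  have "\<exists>y \<in> V \<inter> (D \<inter> E). u y < v y"
  proof (rule ccontr)
    assume *: "\<not> (\<exists>y \<in> V \<inter> (D \<inter> E). u y < v y)"
    have "v x \<le> u x"
      by (rule ML0_le_on_dense[OF v u openin_Int[OF oD oE] dense_inter[OF oD D(1) E(1)] V])
        (use * in \<open>simp add: Bex_def not_less\<close>)
    then show False using less by simp
  qed
  then obtain y where y: "y \<in> V" "y \<in> D" "y \<in> E" "u y < v y" by blast
  obtain r where r: "u y < ereal r" "ereal r < v y" using ereal_dense2[OF y(4)] by blast
  obtain s where s: "ereal r < ereal s" "ereal s < v y" using ereal_dense2[OF r(2)] by blast
  obtain A where A: "openin W A" "y \<in> A" "\<forall>z\<in>A. u z < ereal r" using regular_on_lt[OF D(2) y(2) r(1)] by blast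
  obtain B where B: "openin W B" "y \<in> B" "\<forall>z\<in>B. ereal s < v z" using regular_on_gt[OF E(2) y(3) s(2)] by blast
  show thesis
  proof (rule that[of "V \<inter> (A \<inter> B)" r s])
    show "openin W (V \<inter> (A \<inter> B))" using V A B by (simp add: openin_Int)
    show "V \<inter> (A \<inter> B) \<noteq> {}" using y A B by blast
    show "r < s" using s by simp
    show "u z \<le> ereal r \<and> ereal s \<le> v z" if "z \<in> V \<inter> (A \<inter> B)" for z
      using that A(3) B(3) by (simp add: less_imp_le)
  qed blast
qed

section \<open>Order convergent sequences of intervals\<close>

lemma topspace_Wt [simp]: "topspace Wt = Om"
  by (simp add: Wt_def)

lemma regular_space_Wt: "regular_space Wt"
  unfolding Wt_def
  by (intro metrizable_imp_regular_space metrizable_space_subtopology metrizable_space_euclidean)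

lemma regular_space_shrink:
  assumes "regular_space W" "openin W V" "V \<noteq> {}"
  obtains V' where "openin W V'" "V' \<noteq> {}" "V' \<subseteq> V" "W closure_of V' \<subseteq> V"
proof -
  obtain x where "x \<in> V" using assms by blast
  then obtain U C where UC: "openin W U" "closedin W C" "x \<in> U" "U \<subseteq> C" "C \<subseteq> V"
    using assms(1,2) unfolding neighbourhood_base_of_closedin[symmetric] neighbourhood_base_of by meson
  then have "W closure_of U \<subseteq> V" by (meson closure_of_minimal order_trans)
  with UC show thesis by (intro that[of U]) auto
qed

text \<open>The clause that \<open>Jo\<close> imposes on each of its sequences, word for word, so
  that \<open>Jo_iff\<close> is mere unfolding.\<close>

definition converging :: "(nat \<Rightarrow> mlf set) \<Rightarrow> bool" where
  "converging \<Sigma> \<longleftrightarrow>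
     (\<forall>n. \<Sigma> n \<noteq> {} \<and> (\<exists>a b. a \<in> ML0 Wt \<and> b \<in> ML0 Wt \<and> \<Sigma> n = ointerval a b)) \<and>
     decseq \<Sigma> \<and>
     (\<forall>V. openin Wt V \<longrightarrow>
        (\<exists>u\<in>ML0 Wt. (\<Inter>n. (\<lambda>w. restrict w V) ` \<Sigma> n) = {restrict u V}) \<or>
        (\<Inter>n. (\<lambda>w. restrict w V) ` \<Sigma> n) = {})"

text \<open>Only a gap that is uniform on an open set counts: the pointwise limits of
  \<open>a n\<close> and \<open>b n\<close> may well differ at a single point.\<close>

definition gapless :: "(nat \<Rightarrow> mlf) \<Rightarrow> (nat \<Rightarrow> mlf) \<Rightarrow> bool" where
  "gapless a b \<longleftrightarrow> (\<forall>V r s. openin Wt V \<longrightarrow> V \<noteq> {} \<longrightarrow> r < s \<longrightarrow>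
     \<not> (\<forall>n. \<forall>x\<in>V. a n x \<le> ereal r \<and> ereal s \<le> b n x))"

definition bracket :: "(nat \<Rightarrow> mlf) \<Rightarrow> (nat \<Rightarrow> mlf) \<Rightarrow> bool" where
  "bracket a b \<longleftrightarrow> (\<forall>n. a n \<in> ML0 Wt \<and> b n \<in> ML0 Wt \<and> a n \<le> b n) \<and> incseq a \<and> decseq b \<and> gapless a b"

lemma ointerval_bounds: "w \<in> ointerval a b \<Longrightarrow> a \<le> w \<and> w \<le> b \<and> w \<in> ML0 Wt"
  by (simp add: ointerval_def)

lemma restrict_eqD: "restrict u V = restrict v V \<Longrightarrow> x \<in> V \<Longrightarrow> u x = v x"
  by (metis restrict_apply')

text \<open>If two restrictions survive at every level and differ at a point,
  \<open>ML0_less_gap\<close> separates their representatives by some r < s on an open V'. Every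
  lower end is then at most r there and every upper end at least s, which is a gap.\<close>

lemma converging_bracket:
  assumes "bracket a b"
  shows "converging (\<lambda>n. ointerval (a n) (b n))"
proof -
  have a: "a n \<in> ML0 Wt" and b: "b n \<in> ML0 Wt" and ab: "a n \<le> b n" for n
    using assms by (auto simp: bracket_def)
  have inc: "incseq a" and dec: "decseq b" and gap: "gapless a b"
    using assms by (auto simp: bracket_def)
  let ?\<Sigma> = "\<lambda>n. ointerval (a n) (b n)"
  have dec\<Sigma>: "decseq ?\<Sigma>"
    unfolding decseq_def ointerval_def
    using incseqD[OF inc] decseqD[OF dec] by (auto intro: order_trans)
  have no_less: False
    if V: "openin Wt V" and z: "z1 \<in> (\<Inter>n. (\<lambda>w. restrict w V) ` ?\<Sigma> n)" "z2 \<in> (\<Inter>n. (\<lambda>w. restrict w V) ` ?\<Sigma> n)"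
      and x: "x \<in> V" "z1 x < z2 x" for V z1 z2 x
  proof -
    \<comment> \<open>The representatives are fixed at level 0; those of other levels agree with
      them on V, which contains V'.\<close>
    obtain u1 where u1: "u1 \<in> ?\<Sigma> 0" "z1 = restrict u1 V" using z(1) by blast
    obtain u2 where u2: "u2 \<in> ?\<Sigma> 0" "z2 = restrict u2 V" using z(2) by blast
    have u: "u1 \<in> ML0 Wt" "u2 \<in> ML0 Wt" using u1 u2 ointerval_bounds by auto
    have "u1 x < u2 x" using x u1 u2 by simp
    then obtain V' r s where V': "openin Wt V'" "V' \<noteq> {}" "V' \<subseteq> V" "r < s"
      "\<And>y. y \<in> V' \<Longrightarrow> u1 y \<le> ereal r \<and> ereal s \<le> u2 y"
      using ML0_less_gap[OF u V x(1)] by blast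
    have "a n y \<le> ereal r \<and> ereal s \<le> b n y" if y: "y \<in> V'" for n y
    proof -
      obtain w1 where w1: "w1 \<in> ?\<Sigma> n" "z1 = restrict w1 V" using z(1) by blast
      obtain w2 where w2: "w2 \<in> ?\<Sigma> n" "z2 = restrict w2 V" using z(2) by blast
      have "y \<in> V" using y V'(3) by blast
      then have "w1 y = u1 y" "w2 y = u2 y"
        using restrict_eqD[of w1 V u1 y] restrict_eqD[of w2 V u2 y] w1(2) w2(2) u1(2) u2(2) by auto
      moreover have "a n y \<le> w1 y" "w2 y \<le> b n y"
        using ointerval_bounds[OF w1(1)] ointerval_bounds[OF w2(1)] by (blast dest: le_funD)+
      ultimately show ?thesis using V'(5)[OF y] by (metis order_trans)
    qed
    then show False using gap V' unfolding gapless_def by blast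
  qed
  show ?thesis
    unfolding converging_def
  proof (intro conjI allI impI dec\<Sigma>)
    fix n
    have "a n \<in> ?\<Sigma> n" using a ab by (simp add: ointerval_def)
    then show "?\<Sigma> n \<noteq> {}" by blast
    show "\<exists>a' b'. a' \<in> ML0 Wt \<and> b' \<in> ML0 Wt \<and> ?\<Sigma> n = ointerval a' b'" using a b by blast
  next
    fix V assume V: "openin Wt V"
    let ?I = "\<Inter>n. (\<lambda>w. restrict w V) ` ?\<Sigma> n"
    show "(\<exists>u\<in>ML0 Wt. ?I = {restrict u V}) \<or> ?I = {}"
    proof (cases "?I = {}")
      case False
      then obtain z where z: "z \<in> ?I" by blast
      then obtain u where u: "u \<in> ?\<Sigma> 0" "z = restrict u V" by blast
      have "z' = z" if z': "z' \<in> ?I" for z'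
      proof
        fix x
        obtain u' where u': "z' = restrict u' V" using z' by blast
        show "z' x = z x"
        proof (cases "x \<in> V")
          case True
          then show ?thesis using no_less[OF V z z' True] no_less[OF V z' z True] by (metis linorder_less_linear)
        qed (simp add: u u')
      qed
      then have "?I = {restrict u V}" using z u(2) by blast
      then show ?thesis using ointerval_bounds[OF u(1)] by blast
    qed blast
  qed
qed

text \<open>Both ends belong to their interval, so nesting makes them monotone. If there were a gap
  between r and s, every constant from r to s could be patched into all the intervals over a smaller
  set V2, and the intersection over V2 would have more than one element.\<close>

lemma converging_obtain_bracket:
  assumes "converging \<Sigma>"
  obtains a b where "bracket a b" "\<Sigma> = (\<lambda>n. ointerval (a n) (b n))"
proof -
  have "\<forall>n. \<exists>a b. a \<in> ML0 Wt \<and> b \<in> ML0 Wt \<and> \<Sigma> n = ointerval a b"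
    using assms by (simp add: converging_def)
  then obtain a b where ab: "\<And>n. a n \<in> ML0 Wt" "\<And>n. b n \<in> ML0 Wt" "\<And>n. \<Sigma> n = ointerval (a n) (b n)"
    by metis
  have ne: "\<Sigma> n \<noteq> {}" and dec: "decseq \<Sigma>" for n using assms by (auto simp: converging_def)
  have le: "a n \<le> b n" for n
    using ne[of n] unfolding ab(3) ointerval_def by (auto intro: order_trans)
  then have mem: "a n \<in> \<Sigma> n" "b n \<in> \<Sigma> n" for n using ab by (auto simp: ointerval_def)
  have mem': "a n \<in> \<Sigma> m" "b n \<in> \<Sigma> m" if "m \<le> n" for m n
    using mem[of n] decseqD[OF dec that] by auto
  have inc_a: "incseq a" and dec_b: "decseq b"
    using mem' unfolding incseq_def decseq_def ab(3) ointerval_def by auto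
  have "gapless a b"
    unfolding gapless_def
  proof (intro allI impI notI)
    fix V and r s :: real
    assume V: "openin Wt V" "V \<noteq> {}" and rs: "r < s"
      and gap: "\<forall>n. \<forall>x\<in>V. a n x \<le> ereal r \<and> ereal s \<le> b n x"
    \<comment> \<open>Patching requires finite lower ends. Finiteness of \<open>a 0\<close>
      suffices, since \<open>a 0\<close> \<le> \<open>a n\<close> \<le> r on V1.\<close>
    define A where "A = {x \<in> topspace Wt. \<bar>a 0 x\<bar> \<noteq> \<infinity>}"
    have A: "openin Wt A" "Wt closure_of A = topspace Wt"
      unfolding A_def by (intro ML0_finite_set ab)+
    define V1 where "V1 = V \<inter> A"
    have V1: "openin Wt V1" unfolding V1_def by (intro openin_Int V A)
    have "V1 \<noteq> {}"
      using A(2) V unfolding dense_intersects_open V1_def by (metis Int_commute)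
    then obtain V2 where V2: "openin Wt V2" "V2 \<noteq> {}" "V2 \<subseteq> V1" "Wt closure_of V2 \<subseteq> V1"
      using regular_space_shrink[OF regular_space_Wt V1] by blast
    have V1_r: "a n x \<le> ereal r" "ereal s \<le> b n x" if "x \<in> V1" for n x
      using gap that unfolding V1_def by (meson IntD1)+
    have fin: "\<bar>a n x\<bar> \<noteq> \<infinity>" if "x \<in> V1" for n x
    proof -
      have "\<bar>a 0 x\<bar> \<noteq> \<infinity>" using that unfolding V1_def A_def mem_Collect_eq Int_iff by (elim conjE)
      moreover have "a 0 x \<le> a n x" by (rule le_funD[OF incseqD[OF inc_a]]) simp
      ultimately show ?thesis using V1_r(1)[OF that, of n] by (cases "a 0 x"; cases "a n x") auto
    qed
    have in_all: "restrict (\<lambda>_. ereal c) V2 \<in> (\<Inter>n. (\<lambda>w. restrict w V2) ` \<Sigma> n)" if c: "r \<le> c" "c \<le> s" for c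
    proof
      fix n
      have le_c: "a n x \<le> ereal c" if "x \<in> V1" for x using V1_r(1)[OF that, of n] c by (meson ereal_less_eq(3) order_trans)
      obtain w where w: "w \<in> ML0 Wt" "a n \<le> w" "\<forall>x\<in>V2. w x = ereal c"
        "\<forall>b\<in>ML0 Wt. a n \<le> b \<longrightarrow> (\<forall>x\<in>V2. ereal c \<le> b x) \<longrightarrow> w \<le> b"
        using ML0_patch[OF ab(1)[of n] V1 fin le_c V2(1,4)] by auto
      have "ereal c \<le> b n x" if "x \<in> V2" for x
        using V1_r(2)[of x n] that V2(3) c by (meson ereal_less_eq(3) order_trans subsetD)
      then have "w \<in> \<Sigma> n" using w(1,2) w(4) ab(2)[of n] le[of n] by (simp add: ab(3) ointerval_def)
      moreover have "restrict (\<lambda>_. ereal c) V2 = restrict w V2" using w(3) by (auto simp: restrict_def)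
      ultimately show "restrict (\<lambda>_. ereal c) V2 \<in> (\<lambda>w. restrict w V2) ` \<Sigma> n" by blast
    qed
    have "(\<exists>u\<in>ML0 Wt. (\<Inter>n. (\<lambda>w. restrict w V2) ` \<Sigma> n) = {restrict u V2}) \<or>
        (\<Inter>n. (\<lambda>w. restrict w V2) ` \<Sigma> n) = {}"
      using assms V2(1) unfolding converging_def by meson
    then have "restrict (\<lambda>_. ereal r) V2 = restrict (\<lambda>_. ereal s) V2"
      using in_all[of r] in_all[of s] rs by (metis empty_iff less_imp_le order_refl singletonD)
    then show False using V2(2) rs restrict_eqD[of "\<lambda>_. ereal r" V2 "\<lambda>_. ereal s"] by auto
  qed
  then have "bracket a b" using ab(1,2) le inc_a dec_b by (simp add: bracket_def)
  moreover have "\<Sigma> = (\<lambda>n. ointerval (a n) (b n))" using ab(3) by (rule ext)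
  ultimately show thesis by (rule that)
qed

text \<open>The pointwise maximum of two elements of ML0 may be infinite on a set that is not closed, even
  after regularization. The upper bound constructed here is therefore forced
  to be infinite wherever the maximum is locally unbounded above. The insertion of the origin keeps
  the set nonempty, since infdist to the empty set is 0.\<close>

definition unbounded_above :: "mlf \<Rightarrow> pt set" where
  "unbounded_above u = insert (0, 0) {x \<in> Om. upperS Wt u x = \<infinity>}"

text \<open>On the set itself the value is infinite, the extended inverse of 0 being infinite. Off
  the set, subtracting n lets the barrier sink to minus infinity locally uniformly, so it leaves no
  trace in the limit, and it does so monotonically, as a sequence of upper ends must.\<close>

definition barrier :: "mlf \<Rightarrow> nat \<Rightarrow> pt \<Rightarrow> ereal" where
  "barrier u n x = inverse (ereal (infdist x (unbounded_above u))) - ereal (real n)"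

section \<open>Properties of the unbounded set and of the barrier\<close>

lemma upperS_infinity_closed: "openin Wt {x \<in> Om. upperS Wt u x < \<infinity>}"
  unfolding openin_subopen[of _ "{x \<in> Om. upperS Wt u x < \<infinity>}"]
proof
  fix x assume x: "x \<in> {x \<in> Om. upperS Wt u x < \<infinity>}"
  then obtain r where r: "upperS Wt u x < ereal r" by (auto dest: less_PInf_Ex_of_nat[THEN iffD1])
  then obtain U where U: "openin Wt U" "x \<in> U" "\<And>y. y \<in> U \<Longrightarrow> u y < ereal r" by (rule upperS_lessD) blast
  have "upperS Wt u y < \<infinity>" if "y \<in> U" for y
  proof -
    have "upperS Wt u y \<le> ereal r" by (rule upperS_leI[OF U(1) that]) (use U(3) in \<open>simp add: less_imp_le\<close>)
    then show ?thesis by (rule le_less_trans) simp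
  qed
  then show "\<exists>T. openin Wt T \<and> x \<in> T \<and> T \<subseteq> {x \<in> Om. upperS Wt u x < \<infinity>}"
    using U(1,2) openin_subset[OF U(1)] by (intro exI[of _ U]) auto
qed

lemma closed_Om: "closed Om"
  unfolding Om_def by (intro closed_Collect_le continuous_intros)

lemma closedin_Wt: "closedin Wt C \<longleftrightarrow> closed C \<and> C \<subseteq> Om"
  unfolding Wt_def using closed_Om by (auto simp: closedin_closed_eq)

lemma openin_WtI: "open T \<Longrightarrow> openin Wt (Om \<inter> T)"
  by (auto simp: Wt_def openin_open)

text \<open>The origin is adjoined to every \<open>unbounded_above u\<close>. As it is not isolated,
  removing it from an open dense set keeps the set dense.\<close>

lemma Om_origin_not_open: "\<not> openin Wt {(0, 0)}"
proof
  assume "openin Wt {(0, 0)}"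
  then obtain T where T: "open T" "{(0, 0)} = Om \<inter> T" by (auto simp: Wt_def openin_open)
  then obtain e where e: "e > 0" "ball (0, 0) e \<subseteq> T" by (metis IntD2 insertI1 open_contains_ball)
  have "(0, e / 2) \<in> Om \<inter> T" using e by (auto simp: Om_def dist_Pair_Pair intro!: subsetD[OF e(2)])
  then have "(0, e / 2) \<in> {(0::real^3, 0::real)}" using T(2) by blast
  then show False using e by simp
qed

lemma unbounded_above_closed: "closed (unbounded_above u)" "unbounded_above u \<subseteq> Om" "unbounded_above u \<noteq> {}"
proof -
  have "closedin Wt {x \<in> Om. upperS Wt u x = \<infinity>}"
  proof -
    have "{x \<in> Om. upperS Wt u x = \<infinity>} = topspace Wt - {x \<in> Om. upperS Wt u x < \<infinity>}" by auto
    then show ?thesis using upperS_infinity_closed by (simp only: closedin_diff closedin_topspace)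
  qed
  then show "closed (unbounded_above u)" "unbounded_above u \<subseteq> Om" "unbounded_above u \<noteq> {}"
    unfolding unbounded_above_def closedin_Wt by (auto simp: Om_def)
qed

lemma barrier_infinite: "x \<in> unbounded_above u \<Longrightarrow> barrier u n x = \<infinity>"
  by (simp add: barrier_def)

lemma barrier_real:
  assumes "x \<notin> unbounded_above u"
  shows "infdist x (unbounded_above u) > 0"
    "barrier u n x = ereal (inverse (infdist x (unbounded_above u)) - real n)"
proof -
  show "infdist x (unbounded_above u) > 0"
    using assms unbounded_above_closed[of u] infdist_pos_not_in_closed by blast
  then show "barrier u n x = ereal (inverse (infdist x (unbounded_above u)) - real n)"
    by (simp add: barrier_def)
qed

lemma unbounded_above_mono:
  assumes "\<And>x. x \<in> Om \<Longrightarrow> u x \<le> v x"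
  shows "unbounded_above u \<subseteq> unbounded_above v"
proof -
  have "upperS Wt u x \<le> upperS Wt v x" if "x \<in> Om" for x
    by (rule upperS_mono_on[of Wt Om]) (use that assms openin_topspace[of Wt] in auto)
  then have "upperS Wt v x = \<infinity>" if "x \<in> Om" "upperS Wt u x = \<infinity>" for x
    using that by (metis ereal_infty_less_eq(1))
  then show ?thesis unfolding unbounded_above_def by blast
qed

text \<open>A smaller function has a smaller unbounded set, hence larger distances to it and smaller
  inverses; the subtracted n acts in the same direction.\<close>

lemma barrier_antimono:
  assumes le: "\<And>x. x \<in> Om \<Longrightarrow> v x \<le> u x" and mn: "m \<le> n"
  shows "barrier v n x \<le> barrier u m x"
proof (cases "x \<in> unbounded_above u")
  case True then show ?thesis by (simp add: barrier_infinite)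
next
  case False
  have sub: "unbounded_above v \<subseteq> unbounded_above u" by (rule unbounded_above_mono[OF le])
  then have v: "x \<notin> unbounded_above v" using False by blast
  have "infdist x (unbounded_above u) \<le> infdist x (unbounded_above v)"
    by (rule infdist_mono[OF sub unbounded_above_closed(3)])
  then have "inverse (infdist x (unbounded_above v)) \<le> inverse (infdist x (unbounded_above u))"
    using barrier_real(1)[OF False] by (rule le_imp_inverse_le)
  then show ?thesis using mn by (simp add: barrier_real(2)[OF False] barrier_real(2)[OF v])
qed

lemma unbounded_above_regular:
  assumes reg: "regular_on Wt D u"
  shows "unbounded_above u \<inter> D \<subseteq> {(0, 0)}"
proof
  fix x assume x: "x \<in> unbounded_above u \<inter> D"
  have "upperS Wt u x \<le> u x" "\<bar>u x\<bar> \<noteq> \<infinity>" using reg x by (simp_all add: regular_on_def)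
  then have "upperS Wt u x \<noteq> \<infinity>" by auto
  then show "x \<in> {(0, 0)}" using x by (simp add: unbounded_above_def)
qed

lemma barrier_regular:
  assumes "openin Wt D" "D \<inter> unbounded_above u = {}"
  shows "regular_on Wt D (barrier u n)"
proof (rule regular_onI[OF assms(1)])
  have notin: "x \<notin> unbounded_above u" if "x \<in> D" for x using assms(2) that by blast
  show "\<bar>barrier u n x\<bar> \<noteq> \<infinity>" if "x \<in> D" for x by (simp add: barrier_real(2)[OF notin[OF that]])
  have D: "D \<subseteq> Om" using openin_subset[OF assms(1)] by simp
  have "continuous_on D (\<lambda>x. inverse (infdist x (unbounded_above u)) - real n)"
    using barrier_real(1)[OF notin] by (intro continuous_intros) (auto simp: less_imp_neq[symmetric])
  then have "continuous_on D (\<lambda>x. real_of_ereal (barrier u n x))"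
    by (rule continuous_on_eq) (simp add: barrier_real(2)[OF notin])
  moreover have "subtopology Wt D = top_of_set D" using D by (simp add: Wt_def subtopology_subtopology inf_absorb2)
  ultimately show "continuous_map (subtopology Wt D) euclideanreal (\<lambda>x. real_of_ereal (barrier u n x))"
    by simp
qed

definition barrier_max :: "mlf \<Rightarrow> nat \<Rightarrow> mlf" where
  "barrier_max u n = IS Wt (\<lambda>x. max (u x) (barrier u n x))"

lemma barrier_max_regular:
  assumes D: "Wt closure_of D = topspace Wt" and reg: "regular_on Wt D u"
  obtains E where "Wt closure_of E = topspace Wt" "E \<subseteq> D"
    "regular_on Wt E (\<lambda>x. max (u x) (barrier u n x))"
proof
  let ?E = "D - {(0, 0)}"
  note oD = regular_on_open[OF reg]
  have "closedin Wt {(0, 0)}" by (simp add: closedin_Wt Om_def)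
  then have oE: "openin Wt ?E" using oD by (rule openin_diff[rotated])
  show "Wt closure_of ?E = topspace Wt"
    unfolding dense_intersects_open
  proof (intro allI impI)
    fix T assume T: "openin Wt T \<and> T \<noteq> {}"
    then have "openin Wt (D \<inter> T)" "D \<inter> T \<noteq> {}" using oD D unfolding dense_intersects_open by blast+
    moreover from this(1) have "D \<inter> T \<noteq> {(0, 0)}" using Om_origin_not_open by metis
    ultimately show "?E \<inter> T \<noteq> {}" by blast
  qed
  show "?E \<subseteq> D" by blast
  show "regular_on Wt ?E (\<lambda>x. max (u x) (barrier u n x))"
    using unbounded_above_regular[OF reg]
    by (intro regular_on_max regular_on_subset[OF reg oE] barrier_regular oE) auto
qed

text \<open>The barrier makes the finite set computable: it is the complement of the closed set ?Q.
  Near a point of ?Q the barrier blows up. Near any other point u is bounded above, because its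
  upper envelope is finite there, and the barrier is bounded on both sides.\<close>

lemma barrier_max_in_ML0:
  assumes D: "Wt closure_of D = topspace Wt" and reg: "regular_on Wt D u"
  shows "barrier_max u n \<in> ML0 Wt"
proof -
  let ?m = "\<lambda>x. max (u x) (barrier u n x)" and ?Q = "unbounded_above u"
  obtain E where E: "Wt closure_of E = topspace Wt" "regular_on Wt E ?m"
    using barrier_max_regular[OF D reg, of n] by metis
  have oQ: "openin Wt (Om - ?Q)"
    using unbounded_above_closed[of u] openin_topspace[of Wt] by (intro openin_diff) (auto simp: closedin_Wt)
  have inf: "IS Wt ?m x = \<infinity>" if x: "x \<in> ?Q" for x
  proof -
    have xO: "x \<in> Om" using unbounded_above_closed(2)[of u] x by blast
    have "ereal r \<le> IS Wt ?m x" for r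
    proof -
      \<comment> \<open>Within this radius the inverse distance exceeds |r| + n + 1, so the barrier
        exceeds r even after n is subtracted.\<close>
      define e where "e = inverse (\<bar>r\<bar> + real n + 1)"
      have e: "e > 0" by (simp add: e_def)
      show ?thesis
      proof (rule IS_ge_const[OF openin_WtI[OF open_ball[of x e]]])
        show "x \<in> Om \<inter> ball x e" using xO e by simp
        fix y assume y: "y \<in> Om \<inter> ball x e"
        have "ereal r \<le> barrier u n y"
        proof (cases "y \<in> ?Q")
          case False
          have "infdist y ?Q \<le> dist y x" by (rule infdist_le[OF x])
          also have "\<dots> < e" using y by (simp add: dist_commute)
          finally have "inverse e < inverse (infdist y ?Q)"
            using barrier_real(1)[OF False] by (intro less_imp_inverse_less)
          then have "\<bar>r\<bar> + real n + 1 < inverse (infdist y ?Q)" by (simp add: e_def)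
          then show ?thesis by (simp add: barrier_real(2)[OF False])
        qed (simp add: barrier_infinite)
        then show "ereal r \<le> ?m y" by (simp add: le_max_iff_disj)
      qed
    qed
    then show ?thesis by (rule ereal_top)
  qed
  have fin: "\<bar>IS Wt ?m x\<bar> \<noteq> \<infinity>" if x: "x \<in> Om - ?Q" for x
  proof -
    have xQ: "x \<notin> ?Q" using x by blast
    have "upperS Wt u x < \<infinity>" using x by (auto simp: unbounded_above_def)
    then obtain r where r: "upperS Wt u x < ereal r" by (auto dest: less_PInf_Ex_of_nat[THEN iffD1])
    then obtain U where U: "openin Wt U" "x \<in> U" "\<And>y. y \<in> U \<Longrightarrow> u y < ereal r" by (rule upperS_lessD) blast
    note reg' = barrier_regular[OF oQ, of u n]
    have disj: "(Om - ?Q) \<inter> ?Q = {}" by blast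
    obtain c where c: "barrier u n x = ereal c" using barrier_real(2)[OF xQ] by blast
    obtain A where A: "openin Wt A" "x \<in> A" "\<forall>y\<in>A. barrier u n y < ereal (c + 1)"
      using regular_on_lt[OF reg'[OF disj] x, of "ereal (c + 1)"] c by auto
    obtain B where B: "openin Wt B" "x \<in> B" "\<forall>y\<in>B. ereal (c - 1) < barrier u n y"
      using regular_on_gt[OF reg'[OF disj] x, of "ereal (c - 1)"] c by auto
    define d where "d = max r (c + 1)"
    have "IS Wt ?m x \<le> ereal d"
    proof (rule IS_const_le[OF openin_Int[OF U(1) A(1)]])
      show "x \<in> U \<inter> A" using U A by blast
      fix y assume y: "y \<in> U \<inter> A"
      have "u y \<le> ereal r" "barrier u n y \<le> ereal (c + 1)"
        using U(3)[of y] A(3) y by (simp_all add: less_imp_le)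
      then show "?m y \<le> ereal d" unfolding d_def by (metis ereal_max max.mono)
    qed
    \<comment> \<open>The lower bound is taken from the barrier, since u itself may be unbounded
      below near x.\<close>
    moreover have "ereal (c - 1) \<le> IS Wt ?m x"
      by (rule IS_ge_const[OF B(1,2)]) (use B(3) in \<open>simp add: le_max_iff_disj less_imp_le\<close>)
    ultimately show ?thesis by (cases "IS Wt ?m x") simp_all
  qed
  have "{x \<in> topspace Wt. \<bar>IS Wt ?m x\<bar> \<noteq> \<infinity>} = Om - ?Q"
  proof (rule set_eqI)
    fix x show "x \<in> {x \<in> topspace Wt. \<bar>IS Wt ?m x\<bar> \<noteq> \<infinity>} \<longleftrightarrow> x \<in> Om - ?Q"
      using inf[of x] fin[of x] by (cases "x \<in> ?Q"; cases "x \<in> Om"; simp)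
  qed
  then show ?thesis
    unfolding barrier_max_def by (intro IS_in_ML0[OF E]) (simp only: oQ)
qed

lemma barrier_max_ge:
  assumes "v \<in> ML0 Wt" "\<And>x. x \<in> Om \<Longrightarrow> v x \<le> u x"
  shows "v \<le> barrier_max u n"
proof (rule le_funI)
  fix x
  have "IS Wt v x \<le> barrier_max u n x" if "x \<in> Om"
    unfolding barrier_max_def
    by (rule IS_mono_on[of Wt Om]) (use that assms(2) openin_topspace[of Wt] in \<open>auto simp: le_max_iff_disj\<close>)
  then show "v x \<le> barrier_max u n x"
    using ML0_IS[OF assms(1), of x] ML0_outside[OF assms(1), of x]
    by (cases "x \<in> Om") (simp_all add: barrier_max_def IS_def)
qed

lemma barrier_max_antimono:
  assumes le: "\<And>x. x \<in> Om \<Longrightarrow> v x \<le> u x" and mn: "m \<le> n"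
  shows "barrier_max v n \<le> barrier_max u m"
proof (rule le_funI)
  fix x
  show "barrier_max v n x \<le> barrier_max u m x"
  proof (cases "x \<in> Om")
    case True
    then show ?thesis unfolding barrier_max_def
      by (intro IS_mono_on[of Wt Om] max.mono le barrier_antimono[OF le mn])
        (use openin_topspace[of Wt] in auto)
  qed (simp add: barrier_max_def IS_def)
qed

text \<open>The merged ends are the minimum and the maximum corrected by the barrier. Overlap at
  every level gives \<open>a n\<close> \<le> \<open>d n\<close> and \<open>c n\<close> \<le>
  \<open>b n\<close>; through these two inequalities a gap of the merged pair becomes, on a smaller
  open set, a gap of (a, b) or of (c, d).\<close>

lemma bracket_merge:
  assumes br1: "bracket a b" and br2: "bracket c d"
    and meet: "\<And>n. ointerval (a n) (b n) \<inter> ointerval (c n) (d n) \<noteq> {}"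
  shows "\<exists>l e. bracket l e \<and> (\<forall>n. l n \<le> a n \<and> l n \<le> c n \<and> b n \<le> e n \<and> d n \<le> e n)"
proof -
  have a: "a n \<in> ML0 Wt" and b: "b n \<in> ML0 Wt" and c: "c n \<in> ML0 Wt" and d: "d n \<in> ML0 Wt"
    and ab: "a n \<le> b n" for n
    using br1 br2 by (auto simp: bracket_def)
  have inc: "incseq a" "incseq c" and dec: "decseq b" "decseq d" and gap: "gapless a b" "gapless c d"
    using br1 br2 by (auto simp: bracket_def)
  have am: "a m x \<le> a n x" and cm: "c m x \<le> c n x" and bm: "b n x \<le> b m x" and dm: "d n x \<le> d m x"
    if "m \<le> n" for m n x
    using incseqD[OF inc(1) that] incseqD[OF inc(2) that] decseqD[OF dec(1) that] decseqD[OF dec(2) that]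
    by (blast dest: le_funD)+
  have meet': "a n \<le> d n" "c n \<le> b n" for n
    using meet[of n] unfolding ointerval_def by (auto intro: order_trans)
  define l where "l = (\<lambda>n x. min (a n x) (c n x))"
  define u where "u = (\<lambda>n x. max (b n x) (d n x))"
  define e where "e = (\<lambda>n. barrier_max (u n) n)"
  have um: "u n x \<le> u m x" if "m \<le> n" for m n x
    using bm[OF that] dm[OF that] unfolding u_def by (intro max.mono) auto
  have regular_u: "\<exists>D. Wt closure_of D = topspace Wt \<and> regular_on Wt D (u n) \<and> regular_on Wt D (b n)" for n
  proof -
    obtain D where D: "Wt closure_of D = topspace Wt" "regular_on Wt D (b n)" by (rule ML0_regular[OF b])
    obtain E where E: "Wt closure_of E = topspace Wt" "regular_on Wt E (d n)" by (rule ML0_regular[OF d])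
    note oDE = openin_Int[OF regular_on_open[OF D(2)] regular_on_open[OF E(2)]]
    have "regular_on Wt (D \<inter> E) (b n)" "regular_on Wt (D \<inter> E) (d n)"
      by (rule regular_on_subset[OF D(2) oDE] regular_on_subset[OF E(2) oDE]; blast)+
    then have "regular_on Wt (D \<inter> E) (u n)" "regular_on Wt (D \<inter> E) (b n)"
      unfolding u_def by (simp_all add: regular_on_max)
    then show ?thesis using dense_inter[OF regular_on_open[OF D(2)] D(1) E(1)] by blast
  qed
  have l: "l n \<in> ML0 Wt" for n unfolding l_def by (intro min_in_ML0 a c)
  have e: "e n \<in> ML0 Wt" for n unfolding e_def using regular_u[of n] barrier_max_in_ML0 by blast
  have la: "l n \<le> a n" and lc: "l n \<le> c n" for n by (auto simp: l_def le_fun_def)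
  have be: "b n \<le> e n" and de: "d n \<le> e n" for n
    unfolding e_def by (intro barrier_max_ge b d; simp add: u_def)+
  have le: "l n \<le> e n" for n using la ab be by (metis order_trans)
  have incl: "incseq l"
    unfolding incseq_def l_def using am cm by (intro allI impI le_funI min.mono) auto
  have dece: "decseq e"
    unfolding decseq_def e_def using um by (intro allI impI barrier_max_antimono) auto
  have "gapless l e"
    unfolding gapless_def
  proof (intro allI impI notI)
    fix V and r s :: real
    assume V: "openin Wt V" "V \<noteq> {}" and rs: "r < s"
      and bounds: "\<forall>n. \<forall>x\<in>V. l n x \<le> ereal r \<and> ereal s \<le> e n x"
    have VO: "V \<subseteq> Om" using openin_subset[OF V(1)] by simp
    obtain D where D: "Wt closure_of D = topspace Wt" "regular_on Wt D (u 0)" using regular_u by blast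
    obtain x where x: "x \<in> V" "x \<notin> unbounded_above (u 0)"
    proof -
      have ne: "D \<inter> V \<noteq> {}" using D(1) V unfolding dense_intersects_open by blast
      moreover have "openin Wt (D \<inter> V)" by (intro openin_Int V regular_on_open[OF D(2)])
      then have "D \<inter> V \<noteq> {(0, 0)}" using Om_origin_not_open by metis
      ultimately obtain x where "x \<in> D" "x \<in> V" "x \<noteq> (0, 0)" by blast
      then show thesis using unbounded_above_regular[OF D(2)] that by blast
    qed
    \<comment> \<open>With half the distance as radius, points of the ball stay further than
      \<delta> from the unbounded set of \<open>u 0\<close>, hence also from those of all
      \<open>u n\<close>, which it contains.\<close>
    define \<delta> where "\<delta> = infdist x (unbounded_above (u 0)) / 2"
    have \<delta>: "\<delta> > 0" using barrier_real(1)[OF x(2)] by (simp add: \<delta>_def)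
    define V1 where "V1 = V \<inter> (Om \<inter> ball x \<delta>)"
    have V1: "openin Wt V1" unfolding V1_def by (intro openin_Int V openin_WtI open_ball)
    have V1_ne: "V1 \<noteq> {}" using x \<delta> VO by (auto simp: V1_def)
    have V1V: "V1 \<subseteq> V" by (auto simp: V1_def)
    \<comment> \<open>For n \<ge> N the barrier on V1 is below 1/\<delta> - n < s, so the bound s
      \<le> \<open>e n\<close> has to come from the maximum \<open>u n\<close>.\<close>
    obtain N :: nat where N: "inverse \<delta> - s < real N" using reals_Archimedean2 by blast
    have barrier_small: "barrier (u n) n y < ereal s" if n: "n \<ge> N" and y: "y \<in> V1" for n y
    proof -
      have "infdist x (unbounded_above (u 0)) \<le> infdist y (unbounded_above (u 0)) + dist x y"
        by (rule infdist_triangle)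
      moreover have "dist x y < \<delta>" using y by (simp add: V1_def)
      ultimately have "\<delta> < infdist y (unbounded_above (u 0))" by (simp add: \<delta>_def)
      also have "\<dots> \<le> infdist y (unbounded_above (u n))"
        using um[of 0 n] by (intro infdist_mono unbounded_above_mono unbounded_above_closed) auto
      finally have far: "\<delta> < infdist y (unbounded_above (u n))" .
      then have "y \<notin> unbounded_above (u n)" using \<delta> by auto
      moreover have "inverse (infdist y (unbounded_above (u n))) < inverse \<delta>"
        using far \<delta> by (rule less_imp_inverse_less)
      ultimately show ?thesis using N n by (simp add: barrier_real(2))
    qed
    have upper: "ereal s \<le> u n y"
      if n: "n \<ge> N" and E: "regular_on Wt E (\<lambda>x. max (u n x) (barrier (u n) n x))" and y: "y \<in> V1" "y \<in> E" for n E y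
    proof -
      have "e n y = max (u n y) (barrier (u n) n y)"
        unfolding e_def barrier_max_def by (rule IS_regular[OF E y(2)])
      moreover have "ereal s \<le> e n y" using bounds y(1) V1V by blast
      ultimately show ?thesis using barrier_small[OF n y(1)] by (auto simp: le_max_iff_disj dest: leD)
    qed
    \<comment> \<open>If some \<open>a n0\<close> exceeds r' > r on an open set, the minimum forces
      c \<le> r there, while d \<ge> a > r' at late levels by overlap: a gap of (c, d).\<close>
    show False
    proof (cases "\<exists>n0. \<exists>y\<in>V1. ereal r < a n0 y")
      case True
      then obtain n0 y where y: "y \<in> V1" "ereal r < a n0 y" by blast
      obtain r' where r': "ereal r < ereal r'" "ereal r' < a n0 y" using ereal_dense2[OF y(2)] by blast
      have yO: "y \<in> topspace Wt" using y V1V VO by auto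
      obtain A where A: "openin Wt A" "y \<in> A" "\<forall>z\<in>A. ereal r' < a n0 z"
        using ML0_lsc[OF a yO r'(2)] by blast
      have "c n z \<le> ereal r \<and> ereal r' \<le> d n z" if z: "z \<in> V1 \<inter> A" for n z
      proof -
        define m where "m = max n n0"
        have "ereal r' < a n0 z" using A z by blast
        also have "\<dots> \<le> a m z" by (rule am) (simp add: m_def)
        finally have am: "ereal r' < a m z" .
        have "z \<in> V" using z V1V by blast
        then have "l m z \<le> ereal r" using bounds by blast
        moreover have "\<not> a m z \<le> ereal r" using am r'(1) by (meson less_trans not_le)
        ultimately have "c m z \<le> ereal r" by (simp add: l_def min_le_iff_disj)
        moreover have "c n z \<le> c m z" by (rule cm) (simp add: m_def)
        moreover have "d m z \<le> d n z" by (rule dm) (simp add: m_def)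
        moreover have "a m z \<le> d m z" by (rule le_funD[OF meet'(1)])
        ultimately show ?thesis using am by (meson less_imp_le order_trans)
      qed
      moreover have "openin Wt (V1 \<inter> A)" "V1 \<inter> A \<noteq> {}" using V1 A y by (auto intro: openin_Int)
      moreover have "r < r'" using r' by simp
      ultimately show False using gap(2) unfolding gapless_def by blast
    next
      case False
      then have ar: "a n y \<le> ereal r" if "y \<in> V1" for n y using that by (meson not_le)
      obtain E where E: "Wt closure_of (E n) = topspace Wt"
        "regular_on Wt (E n) (\<lambda>x. max (u n x) (barrier (u n) n x))" "regular_on Wt (E n) (b n)" for n
      proof -
        have "\<exists>E. Wt closure_of E = topspace Wt \<and>
          regular_on Wt E (\<lambda>x. max (u n x) (barrier (u n) n x)) \<and> regular_on Wt E (b n)" for n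
        proof -
          obtain D where D: "Wt closure_of D = topspace Wt" "regular_on Wt D (u n)" "regular_on Wt D (b n)"
            using regular_u by blast
          obtain E where "Wt closure_of E = topspace Wt" "E \<subseteq> D"
            "regular_on Wt E (\<lambda>x. max (u n x) (barrier (u n) n x))"
            by (rule barrier_max_regular[OF D(1,2)])
          then show ?thesis using regular_on_subset[OF D(3)] regular_on_open by blast
        qed
        then show thesis using that by metis
      qed
      \<comment> \<open>Now a \<le> r on V1. If some \<open>b n0\<close> drops below s' < s on an
        open set, the maximum forces d \<ge> s there, while c \<le> b < s' at late levels by
        overlap: a gap of (c, d) again. Otherwise b \<ge> s on dense sets, and (a, b) has a
        gap.\<close>
      show False
      proof (cases "\<exists>n0\<ge>N. \<exists>y\<in>V1 \<inter> E n0. b n0 y < ereal s")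
        case True
        then obtain n0 y where n0: "n0 \<ge> N" and y: "y \<in> V1" "y \<in> E n0" "b n0 y < ereal s" by blast
        obtain s' where s': "b n0 y < ereal s'" "ereal s' < ereal s" using ereal_dense2[OF y(3)] by blast
        obtain B where B: "openin Wt B" "y \<in> B" "\<forall>z\<in>B. b n0 z < ereal s'"
          using regular_on_lt[OF E(3) y(2) s'(1)] by blast
        have oVB: "openin Wt (V1 \<inter> B)" by (intro openin_Int V1 B)
        have "c n z \<le> ereal s' \<and> ereal s \<le> d n z" if z: "z \<in> V1 \<inter> B" for n z
        proof -
          define m where "m = max n n0"
          have mN: "m \<ge> N" using n0 by (simp add: m_def)
          have bs: "b m y < ereal s'" if "y \<in> B" for y
            by (rule le_less_trans[OF bm[of n0 m]]) (use B that in \<open>auto simp: m_def\<close>)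
          have "c m z \<le> b m z" by (rule le_funD[OF meet'(2)])
          then have "c m z \<le> ereal s'" using bs[of z] z by (meson IntD2 less_imp_le order_trans)
          moreover have "c n z \<le> c m z" by (rule cm) (simp add: m_def)
          moreover have "d m z \<le> d n z" by (rule dm) (simp add: m_def)
          moreover have "ereal s \<le> d m z"
          proof -
            have oE: "openin Wt (E m)" by (rule regular_on_open[OF E(2)])
            have zO: "z \<in> topspace Wt" using z V1V VO by auto
            \<comment> \<open>The bound is available on the dense set \<open>E m\<close> only;
              comparison with the regularized constant extends it to every point.\<close>
            have "IS Wt (\<lambda>_. ereal s) z \<le> IS Wt (d m) z"
            proof (rule IS_le_on_dense[OF oE E(1) oVB z])
              fix y assume y: "y \<in> V1 \<inter> B" "y \<in> E m"
              have "ereal s \<le> u m y" using upper[OF mN E(2)] y by blast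
              moreover have "b m y < ereal s" using bs[of y] s'(2) y by (meson IntD2 less_trans)
              ultimately show "ereal s \<le> d m y" by (simp add: u_def le_max_iff_disj not_le[symmetric])
            qed
            moreover have "IS Wt (\<lambda>_. ereal s) z = ereal s"
              by (rule IS_regular[OF regular_on_const[OF openin_topspace] zO])
            ultimately show ?thesis by (simp add: ML0_IS[OF d])
          qed
          ultimately show ?thesis by (meson order_trans)
        qed
        moreover have "V1 \<inter> B \<noteq> {}" using y B by blast
        moreover have "s' < s" using s' by simp
        ultimately show False using gap(2) oVB unfolding gapless_def by blast
      next
        case False
        have "a n z \<le> ereal r \<and> ereal s \<le> b n z" if z: "z \<in> V1" for n z
        proof
          define m where "m = max n N"
          have oE: "openin Wt (E m)" by (rule regular_on_open[OF E(2)])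
          have zO: "z \<in> topspace Wt" using z V1V VO by auto
          have "IS Wt (\<lambda>_. ereal s) z \<le> IS Wt (b m) z"
            by (rule IS_le_on_dense[OF oE E(1) V1 z]) (use False in \<open>auto simp: m_def not_less\<close>)
          moreover have "IS Wt (\<lambda>_. ereal s) z = ereal s"
            by (rule IS_regular[OF regular_on_const[OF openin_topspace] zO])
          moreover have "b m z \<le> b n z" by (rule bm) (simp add: m_def)
          ultimately show "ereal s \<le> b n z" by (simp add: ML0_IS[OF b])
        qed (rule ar[OF z])
        then show False using gap(1) V1 V1_ne rs unfolding gapless_def by blast
      qed
    qed
  qed
  then have "bracket l e" using l e le incl dece by (simp add: bracket_def)
  then show ?thesis using la lc be de by blast
qed

lemma converging_merge:
  assumes "converging \<Sigma>" "converging \<Sigma>'" and meet: "\<And>n. \<Sigma> n \<inter> \<Sigma>' n \<noteq> {}"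
  obtains \<Sigma>'' where "converging \<Sigma>''" "\<And>n. \<Sigma> n \<union> \<Sigma>' n \<subseteq> \<Sigma>'' n"
proof -
  obtain a b where ab: "bracket a b" "\<Sigma> = (\<lambda>n. ointerval (a n) (b n))"
    by (rule converging_obtain_bracket[OF assms(1)])
  obtain c d where cd: "bracket c d" "\<Sigma>' = (\<lambda>n. ointerval (c n) (d n))"
    by (rule converging_obtain_bracket[OF assms(2)])
  have "ointerval (a n) (b n) \<inter> ointerval (c n) (d n) \<noteq> {}" for n
    using meet by (simp add: ab cd)
  then obtain l e where le: "bracket l e" "\<forall>n. l n \<le> a n \<and> l n \<le> c n \<and> b n \<le> e n \<and> d n \<le> e n"
    using bracket_merge[OF ab(1) cd(1)] by blast
  show thesis
  proof (rule that[OF converging_bracket[OF le(1)]])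
    show "\<Sigma> n \<union> \<Sigma>' n \<subseteq> ointerval (l n) (e n)" for n
      using le(2) by (auto simp: ab cd ointerval_def intro: order_trans)
  qed
qed

section \<open>Cauchy filters\<close>

lemma eventually_gen_filter:
  assumes "decseq \<Sigma>"
  shows "eventually P (gen_filter \<Sigma>) \<longleftrightarrow> (\<exists>n. \<forall>x\<in>\<Sigma> n. P x)"
  unfolding gen_filter_def
proof (subst eventually_INF_base)
  fix m n :: nat
  show "\<exists>x\<in>UNIV. principal (\<Sigma> x) \<le> inf (principal (\<Sigma> m)) (principal (\<Sigma> n))"
    using decseqD[OF assms, of m "max m n"] decseqD[OF assms, of n "max m n"]
    by (intro bexI[of _ "max m n"]) auto
qed (auto simp: eventually_principal)

lemma le_gen_filter:
  assumes "decseq \<Sigma>"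
  shows "F \<le> gen_filter \<Sigma> \<longleftrightarrow> (\<forall>n. eventually (\<lambda>x. x \<in> \<Sigma> n) F)"
  by (simp add: gen_filter_def le_INF_iff le_principal)

lemma converging_decseq: "converging \<Sigma> \<Longrightarrow> decseq \<Sigma>"
  by (simp add: converging_def)

lemma converging_ML0: "converging \<Sigma> \<Longrightarrow> w \<in> \<Sigma> n \<Longrightarrow> w \<in> ML0 Wt"
  using converging_obtain_bracket ointerval_bounds by metis

lemma filtermap_square:
  fixes h :: "'a \<Rightarrow> 'b"
  shows "filtermap (\<lambda>(a, b). (h a, h b)) (F \<times>\<^sub>F F) = filtermap h F \<times>\<^sub>F filtermap h F"
  unfolding filter_eq_iff eventually_filtermap eventually_prod_same
proof (intro allI iffI)
  fix P :: "'b \<times> 'b \<Rightarrow> bool"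
  assume "\<exists>Q. eventually Q F \<and> (\<forall>x y. Q x \<longrightarrow> Q y \<longrightarrow> P (case (x, y) of (a, b) \<Rightarrow> (h a, h b)))"
  then obtain Q where "eventually Q F" "\<forall>x y. Q x \<longrightarrow> Q y \<longrightarrow> P (h x, h y)" by auto
  then show "\<exists>Q. eventually (\<lambda>x. Q (h x)) F \<and> (\<forall>x y. Q x \<longrightarrow> Q y \<longrightarrow> P (x, y))"
    by (intro exI[of _ "\<lambda>z. \<exists>x. Q x \<and> z = h x"]) (auto elim: eventually_mono)
qed auto

text \<open>One interval sequence in place of the finitely many of \<open>Jo\<close>; by
  \<open>Jo_square\<close> the two agree on squares of filters.\<close>

definition order_cauchy :: "mlf filter \<Rightarrow> bool" where
  "order_cauchy F \<longleftrightarrow> F \<noteq> bot \<and> (\<exists>\<Sigma>. converging \<Sigma> \<and> F \<le> gen_filter \<Sigma>)"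

lemma Jo_iff:
  "\<U> \<in> Jo \<longleftrightarrow> \<U> \<noteq> bot \<and> (\<exists>k::nat\<ge>1. \<exists>\<Sigma>. (\<forall>i<k. converging (\<Sigma> i)) \<and>
     \<U> \<le> (SUP i\<in>{..<k}. gen_filter (\<Sigma> i) \<times>\<^sub>F gen_filter (\<Sigma> i)))"
  unfolding Jo_def converging_def mem_Collect_eq ..

text \<open>Each new sequence meets \<Sigma>0, and \<Sigma>0 stays inside the merged sequence
  throughout the induction, so the next merge is always possible.\<close>

lemma converging_merge_finite:
  assumes "finite M" "converging \<Sigma>0" "\<And>i. i \<in> M \<Longrightarrow> converging (\<Sigma> i)"
    "\<And>i n. i \<in> M \<Longrightarrow> \<Sigma>0 n \<inter> \<Sigma> i n \<noteq> {}"
  shows "\<exists>\<Sigma>'. converging \<Sigma>' \<and> (\<forall>n. \<Sigma>0 n \<subseteq> \<Sigma>' n \<and> (\<forall>i\<in>M. \<Sigma> i n \<subseteq> \<Sigma>' n))"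
  using assms(1,3,4)
proof (induction M rule: finite_induct)
  case empty
  then show ?case using assms(2) by blast
next
  case (insert i M)
  then obtain \<Sigma>' where \<Sigma>': "converging \<Sigma>'" "\<forall>n. \<Sigma>0 n \<subseteq> \<Sigma>' n \<and> (\<forall>i\<in>M. \<Sigma> i n \<subseteq> \<Sigma>' n)" by auto
  have "\<Sigma>' n \<inter> \<Sigma> i n \<noteq> {}" for n using \<Sigma>'(2) insert.prems(2)[of i n] by blast
  then obtain \<Sigma>'' where "converging \<Sigma>''" "\<And>n. \<Sigma>' n \<union> \<Sigma> i n \<subseteq> \<Sigma>'' n"
    using converging_merge[OF \<Sigma>'(1) insert.prems(1)[of i]] by blast
  then show ?case using \<Sigma>'(2) by (intro exI[of _ \<Sigma>'']) blast
qed

text \<open>If the square of F is covered by finitely many squares of interval filters, then those which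
  meet a fixed one of them already cover F, and they can be merged.\<close>

lemma Jo_square: "F \<times>\<^sub>F F \<in> Jo \<longleftrightarrow> order_cauchy F"
proof
  assume "order_cauchy F"
  then obtain \<Sigma> where \<Sigma>: "F \<noteq> bot" "converging \<Sigma>" "F \<le> gen_filter \<Sigma>" by (auto simp: order_cauchy_def)
  show "F \<times>\<^sub>F F \<in> Jo"
    unfolding Jo_iff
  proof (intro conjI exI[of _ "1::nat"] exI[of _ "\<lambda>_. \<Sigma>"])
    show "F \<times>\<^sub>F F \<noteq> bot" using \<Sigma>(1) by (simp add: prod_filter_eq_bot)
    have "(SUP i\<in>{..<1::nat}. gen_filter \<Sigma> \<times>\<^sub>F gen_filter \<Sigma>) = gen_filter \<Sigma> \<times>\<^sub>F gen_filter \<Sigma>"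
      by (rule cSUP_const) auto
    then show "F \<times>\<^sub>F F \<le> (SUP i\<in>{..<1::nat}. gen_filter \<Sigma> \<times>\<^sub>F gen_filter \<Sigma>)"
      using prod_filter_mono[OF \<Sigma>(3) \<Sigma>(3)] by simp
  qed (use \<Sigma> in auto)
next
  assume "F \<times>\<^sub>F F \<in> Jo"
  then obtain k \<Sigma> where ne: "F \<times>\<^sub>F F \<noteq> bot" and conv: "\<And>i. i < (k::nat) \<Longrightarrow> converging (\<Sigma> i)"
    and le: "F \<times>\<^sub>F F \<le> (SUP i\<in>{..<k}. gen_filter (\<Sigma> i) \<times>\<^sub>F gen_filter (\<Sigma> i))"
    unfolding Jo_iff by blast
  have F: "F \<noteq> bot" using ne by (simp add: prod_filter_eq_bot)
  have dec: "decseq (\<Sigma> i)" if "i < k" for i using converging_decseq[OF conv[OF that]] .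
  have "\<exists>Q. eventually Q F \<and> (\<forall>x y. Q x \<longrightarrow> Q y \<longrightarrow> (\<exists>i<k. x \<in> \<Sigma> i n \<and> y \<in> \<Sigma> i n))" for n
  proof -
    have "eventually (\<lambda>(x, y). \<exists>i<k. x \<in> \<Sigma> i n \<and> y \<in> \<Sigma> i n) (SUP i\<in>{..<k}. gen_filter (\<Sigma> i) \<times>\<^sub>F gen_filter (\<Sigma> i))"
      unfolding eventually_Sup
    proof (intro ballI, elim imageE)
      fix G i assume i: "i \<in> {..<k}" and G: "G = gen_filter (\<Sigma> i) \<times>\<^sub>F gen_filter (\<Sigma> i)"
      have "eventually (\<lambda>x. x \<in> \<Sigma> i n) (gen_filter (\<Sigma> i))"
        using dec i by (auto simp: eventually_gen_filter)
      then show "eventually (\<lambda>(x, y). \<exists>i<k. x \<in> \<Sigma> i n \<and> y \<in> \<Sigma> i n) G"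
        unfolding G eventually_prod_same using i by (intro exI[of _ "\<lambda>x. x \<in> \<Sigma> i n"]) auto
    qed
    then have "eventually (\<lambda>(x, y). \<exists>i<k. x \<in> \<Sigma> i n \<and> y \<in> \<Sigma> i n) (F \<times>\<^sub>F F)"
      using le by (rule filter_leD[rotated])
    then show ?thesis unfolding eventually_prod_same by simp
  qed
  then obtain Q where Q: "\<And>n. eventually (Q n) F"
    "\<And>n x y. Q n x \<Longrightarrow> Q n y \<Longrightarrow> \<exists>i<k. x \<in> \<Sigma> i n \<and> y \<in> \<Sigma> i n"
    by metis
  \<comment> \<open>If each sequence were avoided by F at some level, F would avoid all of them at a
    common level N, although every point of \<open>Q N\<close> lies in one of them.\<close>
  obtain i0 where i0: "i0 < k" "\<And>n. \<exists>\<^sub>F x in F. x \<in> \<Sigma> i0 n"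
  proof (rule ccontr)
    assume "\<not> thesis"
    then have "\<forall>i<k. \<exists>n. eventually (\<lambda>x. x \<notin> \<Sigma> i n) F" using that unfolding frequently_def by blast
    then obtain m where m: "\<And>i. i < k \<Longrightarrow> eventually (\<lambda>x. x \<notin> \<Sigma> i (m i)) F" by metis
    define N where "N = Max (insert 0 (m ` {..<k}))"
    have mN: "m i \<le> N" if "i < k" for i unfolding N_def using that by (intro Max_ge) auto
    have "eventually (\<lambda>x. \<forall>i\<in>{..<k}. x \<notin> \<Sigma> i (m i)) F"
      by (rule eventually_ball_finite) (use m in auto)
    then have "eventually (\<lambda>x. False) F"
      using Q(1)[of N]
    proof eventually_elim
      case (elim x)
      then obtain i where "i < k" "x \<in> \<Sigma> i N" using Q(2) by blast
      then show False using elim(1) decseqD[OF dec mN, of i] by auto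
    qed
    then show False using F by simp
  qed
  define M where "M = {i. i < k \<and> (\<forall>n. \<Sigma> i0 n \<inter> \<Sigma> i n \<noteq> {})}"
  have "\<exists>\<Sigma>'. converging \<Sigma>' \<and> (\<forall>n. \<Sigma> i0 n \<subseteq> \<Sigma>' n \<and> (\<forall>i\<in>M. \<Sigma> i n \<subseteq> \<Sigma>' n))"
    by (rule converging_merge_finite) (use conv i0 in \<open>auto simp: M_def\<close>)
  then obtain \<Sigma>' where \<Sigma>': "converging \<Sigma>'" "\<And>n i. i \<in> M \<Longrightarrow> \<Sigma> i n \<subseteq> \<Sigma>' n" by blast
  have "\<forall>i. \<exists>n. i < k \<longrightarrow> i \<notin> M \<longrightarrow> \<Sigma> i0 n \<inter> \<Sigma> i n = {}" by (auto simp: M_def)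
  then obtain m where m: "\<And>i. i < k \<Longrightarrow> i \<notin> M \<Longrightarrow> \<Sigma> i0 (m i) \<inter> \<Sigma> i (m i) = {}" by metis
  define N where "N = Max (insert 0 (m ` {..<k}))"
  have mN: "m i \<le> N" if "i < k" for i unfolding N_def using that by (intro Max_ge) auto
  have "eventually (\<lambda>x. x \<in> \<Sigma>' n) F" for n
  proof -
    define p where "p = max n N"
    \<comment> \<open>Every y in \<open>Q p\<close> shares some \<open>\<Sigma> i p\<close> with the
      fixed point w of \<open>\<Sigma> i0 p\<close>. Since p is at least \<open>m i\<close>, w
      witnesses that the sequences i0 and i meet at level \<open>m i\<close>, so i belongs to
      M.\<close>
    have "\<exists>\<^sub>F x in F. x \<in> \<Sigma> i0 p \<and> Q p x"
      using i0(2)[of p] Q(1)[of p] by (rule frequently_eventually_frequently)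
    from frequently_ex[OF this] obtain w where w: "w \<in> \<Sigma> i0 p" "Q p w" by blast
    show ?thesis
      using Q(1)[of p]
    proof eventually_elim
      case (elim y)
      then obtain i where i: "i < k" "w \<in> \<Sigma> i p" "y \<in> \<Sigma> i p" using Q(2) w(2) by blast
      have "m i \<le> p" using mN[OF i(1)] by (simp add: p_def)
      then have "w \<in> \<Sigma> i0 (m i) \<inter> \<Sigma> i (m i)"
        using decseqD[OF dec[OF i0(1)], of "m i" p] decseqD[OF dec[OF i(1)], of "m i" p] w i by auto
      then have "i \<in> M" using m[OF i(1)] by blast
      then have "y \<in> \<Sigma>' p" using \<Sigma>'(2) i(3) by blast
      then show "y \<in> \<Sigma>' n" using decseqD[OF converging_decseq[OF \<Sigma>'(1)], of n p] by (auto simp: p_def)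
    qed
  qed
  then have "F \<le> gen_filter \<Sigma>'" by (simp add: le_gen_filter converging_decseq[OF \<Sigma>'(1)])
  then show "order_cauchy F" using F \<Sigma>'(1) by (auto simp: order_cauchy_def)
qed

text \<open>G is proper and lies below both interval filters, so the intervals meet at every level;
  the merged sequence covers F and H.\<close>

lemma order_cauchy_trans:
  assumes FG: "order_cauchy (sup F G)" and GH: "order_cauchy (sup G H)" and ne: "F \<noteq> bot" "G \<noteq> bot"
  shows "order_cauchy (sup F H)"
proof -
  obtain \<Sigma> where \<Sigma>: "converging \<Sigma>" "F \<le> gen_filter \<Sigma>" "G \<le> gen_filter \<Sigma>" "sup F G \<noteq> bot"
    using FG by (auto simp: order_cauchy_def)
  obtain \<Sigma>' where \<Sigma>': "converging \<Sigma>'" "G \<le> gen_filter \<Sigma>'" "H \<le> gen_filter \<Sigma>'"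
    using GH by (auto simp: order_cauchy_def)
  note le = le_gen_filter[OF converging_decseq[OF \<Sigma>(1)]] le_gen_filter[OF converging_decseq[OF \<Sigma>'(1)]]
  have "\<Sigma> n \<inter> \<Sigma>' n \<noteq> {}" for n
  proof
    assume "\<Sigma> n \<inter> \<Sigma>' n = {}"
    moreover have "eventually (\<lambda>x. x \<in> \<Sigma> n \<and> x \<in> \<Sigma>' n) G"
      using \<Sigma>(3) \<Sigma>'(2) unfolding le by (simp add: eventually_conj)
    ultimately have "eventually (\<lambda>x. False) G" by (auto elim: eventually_mono)
    then show False using ne by simp
  qed
  then obtain \<Sigma>'' where \<Sigma>'': "converging \<Sigma>''" "\<And>n. \<Sigma> n \<union> \<Sigma>' n \<subseteq> \<Sigma>'' n"
    using converging_merge[OF \<Sigma>(1) \<Sigma>'(1)] by blast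
  have "F \<le> gen_filter \<Sigma>''" "H \<le> gen_filter \<Sigma>''"
    using \<Sigma>(2) \<Sigma>'(3) \<Sigma>''(2) unfolding le le_gen_filter[OF converging_decseq[OF \<Sigma>''(1)]]
    by (blast intro: eventually_mono)+
  then have "sup F H \<le> gen_filter \<Sigma>''" by simp
  then show ?thesis using ne(1) \<Sigma>''(1) unfolding order_cauchy_def by (metis sup_eq_bot_iff)
qed

lemma order_cauchy_ML0: "order_cauchy F \<Longrightarrow> eventually (\<lambda>w. w \<in> ML0 Wt) F"
proof -
  assume "order_cauchy F"
  then obtain \<Sigma> where \<Sigma>: "converging \<Sigma>" "F \<le> gen_filter \<Sigma>" by (auto simp: order_cauchy_def)
  then have "eventually (\<lambda>w. w \<in> \<Sigma> 0) F" using le_gen_filter converging_decseq by blast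
  then show ?thesis by (rule eventually_mono) (rule converging_ML0[OF \<Sigma>(1)])
qed

section \<open>The factor Z and the product structure\<close>

lemma filter_eq_principal_singleton:
  assumes "F \<noteq> bot" "F \<le> principal {w}"
  shows "F = principal {w}"
proof (rule antisym[OF assms(2)], rule filter_leI)
  fix P assume "eventually P F"
  moreover have "eventually (\<lambda>x. x = w) F" using assms(2) by (simp add: le_principal)
  ultimately have "eventually (\<lambda>x. P w) F" by eventually_elim simp
  then show "eventually P (principal {w})" using assms(1) by (simp add: eventually_principal)
qed

text \<open>A set Q whose pairs all lie on finitely many diagonal points contains only one point.
  This is why the approximating sequence has to carry the initial values exactly.\<close>

lemma Jl_square: "F \<times>\<^sub>F F \<in> Jl \<longleftrightarrow> (\<exists>w\<in>Zset. F = principal {w})"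
proof
  assume "\<exists>w\<in>Zset. F = principal {w}"
  then obtain w where w: "w \<in> Zset" "F = principal {w}" by blast
  have "(SUP i\<in>{..<1::nat}. principal {w} \<times>\<^sub>F principal {w}) = principal {w} \<times>\<^sub>F principal {w}"
    by (rule cSUP_const) auto
  then show "F \<times>\<^sub>F F \<in> Jl"
    unfolding Jl_def mem_Collect_eq using w
    by (intro conjI exI[of _ "1::nat"] exI[of _ "\<lambda>_. w"]) (auto simp: prod_filter_eq_bot principal_eq_bot_iff)
next
  assume "F \<times>\<^sub>F F \<in> Jl"
  then obtain k ws where ne: "F \<times>\<^sub>F F \<noteq> bot" and ws: "\<forall>i<(k::nat). ws i \<in> Zset"
    and le: "F \<times>\<^sub>F F \<le> (SUP i\<in>{..<k}. principal {ws i} \<times>\<^sub>F principal {ws i})"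
    unfolding Jl_def by blast
  have F: "F \<noteq> bot" using ne by (simp add: prod_filter_eq_bot)
  have "eventually (\<lambda>(x, y). \<exists>i<k. x = ws i \<and> y = ws i) (SUP i\<in>{..<k}. principal {ws i} \<times>\<^sub>F principal {ws i})"
    by (auto simp: eventually_Sup principal_prod_principal eventually_principal)
  then have "eventually (\<lambda>(x, y). \<exists>i<k. x = ws i \<and> y = ws i) (F \<times>\<^sub>F F)"
    using le by (rule filter_leD[rotated])
  then obtain Q where Q: "eventually Q F" "\<And>x y. Q x \<Longrightarrow> Q y \<Longrightarrow> \<exists>i<k. x = ws i \<and> y = ws i"
    unfolding eventually_prod_same by auto
  obtain w where w: "Q w" using eventually_happens[OF Q(1)] F by blast
  have "F \<le> principal {w}"
    unfolding le_principal by (rule eventually_mono[OF Q(1)]) (use Q(2) w in blast)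
  then have "F = principal {w}" by (rule filter_eq_principal_singleton[OF F])
  moreover have "w \<in> Zset" using Q(2)[OF w w] ws by blast
  ultimately show "\<exists>w\<in>Zset. F = principal {w}" by blast
qed

lemma JP_square:
  "F \<times>\<^sub>F F \<in> JP \<longleftrightarrow> (\<forall>j. order_cauchy (filtermap (\<lambda>v. fst (fst v) j) F)) \<and>
     order_cauchy (filtermap (\<lambda>v. snd (fst v)) F) \<and> (\<exists>w\<in>Zset. filtermap snd F = principal {w})"
proof -
  have 1: "filtermap (\<lambda>(a, b). (fst a, fst b)) (F \<times>\<^sub>F F) = filtermap fst F \<times>\<^sub>F filtermap fst F"
    and 2: "filtermap (\<lambda>(a, b). (snd a, snd b)) (F \<times>\<^sub>F F) = filtermap snd F \<times>\<^sub>F filtermap snd F"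
    by (rule filtermap_square)+
  have 3: "filtermap (\<lambda>(a, b). (fst a j, fst b j)) (G \<times>\<^sub>F G) =
      filtermap (\<lambda>a. fst a j) G \<times>\<^sub>F filtermap (\<lambda>a. fst a j) G"
    and 4: "filtermap (\<lambda>(a, b). (snd a, snd b)) (G \<times>\<^sub>F G) = filtermap snd G \<times>\<^sub>F filtermap snd G"
    for G :: "xel filter" and j
    by (rule filtermap_square)+
  show ?thesis
    unfolding JP_def JY_def mem_Collect_eq 1 2 unfolding 3 4 Jo_square Jl_square filtermap_filtermap conj_assoc ..
qed

text \<open>Transitivity is inherited from each component of Y. In the Z component the image of G is
  proper and lies below both principal filters, which forces their points to coincide.\<close>

lemma JP_square_trans:
  assumes "sup F G \<times>\<^sub>F sup F G \<in> JP" "sup G H \<times>\<^sub>F sup G H \<in> JP" "F \<noteq> bot" "G \<noteq> bot"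
  shows "sup F H \<times>\<^sub>F sup F H \<in> JP"
proof -
  have trans: "order_cauchy (filtermap h (sup F H))"
    if "order_cauchy (filtermap h (sup F G))" "order_cauchy (filtermap h (sup G H))" for h
    using order_cauchy_trans[of "filtermap h F" "filtermap h G" "filtermap h H"] that assms(3,4)
    by (simp add: filtermap_sup filtermap_bot_iff)
  obtain w w' where w: "w \<in> Zset" "filtermap snd (sup F G) = principal {w}"
    and w': "filtermap snd (sup G H) = principal {w'}"
    using assms(1,2) unfolding JP_square by blast
  have "w = w'"
  proof (rule ccontr)
    assume "w \<noteq> w'"
    have "filtermap snd G \<le> principal {w}" "filtermap snd G \<le> principal {w'}"
      using w(2) w' by (simp_all add: filtermap_sup flip: w(2) w')
    then have "filtermap snd G \<le> inf (principal {w}) (principal {w'})" by (rule inf_greatest)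
    then show False using \<open>w \<noteq> w'\<close> assms(4) by (simp add: filtermap_bot_iff bot_unique)
  qed
  then have le: "filtermap snd (sup F H) \<le> principal {w}"
    using w(2) w' by (metis filtermap_sup le_sup_iff sup_ge1 sup_ge2)
  have "filtermap snd (sup F H) = principal {w}"
    by (rule filter_eq_principal_singleton[OF _ le]) (use assms(3) in \<open>simp add: filtermap_bot_iff\<close>)
  then show ?thesis
    using assms(1,2) w(1) trans unfolding JP_square by blast
qed

text \<open>T0 v need not lie in Y, because the finite set of its components may fail to be open; membership
  in JP alone forces a filter into the carrier.\<close>

lemma JP_square_carrier:
  assumes "F \<times>\<^sub>F F \<in> JP"
  shows "F \<noteq> bot" "eventually (\<lambda>v. v \<in> YZset) F"
proof -
  note J = assms[unfolded JP_square]
  show "F \<noteq> bot" using J by (auto simp: order_cauchy_def filtermap_bot_iff)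
  have "eventually (\<lambda>v. \<forall>j. fst (fst v) j \<in> ML0 Wt) F"
    using J order_cauchy_ML0 by (intro eventually_all_finite) (fastforce simp: eventually_filtermap)
  moreover have "eventually (\<lambda>v. snd (fst v) \<in> ML0 Wt) F"
    using J order_cauchy_ML0 by (fastforce simp: eventually_filtermap)
  moreover have "eventually (\<lambda>v. snd v \<in> Zset) F"
  proof -
    obtain w where "w \<in> Zset" "filtermap snd F = principal {w}" using J by blast
    then have "eventually (\<lambda>z. z \<in> Zset) (filtermap snd F)" by (simp add: eventually_principal)
    then show ?thesis by (simp add: eventually_filtermap)
  qed
  ultimately show "eventually (\<lambda>v. v \<in> YZset) F"
    by eventually_elim (auto simp: YZset_def Yset_def)
qed

lemma ucs_cauchy_YZ: "ucs_cauchy YZset JP F \<longleftrightarrow> F \<times>\<^sub>F F \<in> JP"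
  using JP_square_carrier unfolding ucs_cauchy_def by blast

lemma ucs_cauchy_XT0:
  "ucs_cauchy (XT0 \<nu>) (JT0 \<nu>) F \<longleftrightarrow>
     eventually (\<lambda>c. c \<in> XT0 \<nu>) F \<and> ucs_cauchy YZset JP (filtermap (T0hat \<nu>) F)"
proof -
  have "eventually (\<lambda>(c, d). c \<in> XT0 \<nu> \<and> d \<in> XT0 \<nu>) (F \<times>\<^sub>F F)" if "eventually (\<lambda>c. c \<in> XT0 \<nu>) F"
    unfolding eventually_prod_same using that by auto
  moreover have "F \<noteq> bot" if "filtermap (T0hat \<nu>) F \<times>\<^sub>F filtermap (T0hat \<nu>) F \<in> JP"
    using JP_square_carrier(1)[OF that] by (simp add: filtermap_bot_iff)
  ultimately show ?thesis
    unfolding ucs_cauchy_YZ unfolding ucs_cauchy_def JT0_def mem_Collect_eq filtermap_square by blast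
qed

section \<open>Extension of an injection to the completions\<close>

lemma ucs_class_eq_iff:
  assumes trans: "\<And>F G H. ucs_cauchy S J (sup F G) \<Longrightarrow> ucs_cauchy S J (sup G H) \<Longrightarrow> F \<noteq> bot \<Longrightarrow> G \<noteq> bot \<Longrightarrow> ucs_cauchy S J (sup F H)"
    and F: "ucs_cauchy S J F" and G: "ucs_cauchy S J G"
  shows "ucs_class S J F = ucs_class S J G \<longleftrightarrow> ucs_cauchy S J (sup F G)"
proof
  assume "ucs_class S J F = ucs_class S J G"
  moreover have "G \<in> ucs_class S J G" using G by (simp add: ucs_class_def)
  ultimately have "G \<in> ucs_class S J F" by (simp only:)
  then show "ucs_cauchy S J (sup F G)" by (simp add: ucs_class_def)
next
  have bot: "F \<noteq> bot" "G \<noteq> bot" using F G by (auto simp: ucs_cauchy_def)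
  assume FG: "ucs_cauchy S J (sup F G)"
  show "ucs_class S J F = ucs_class S J G"
    unfolding ucs_class_def
    using trans[OF FG _ bot] trans[OF FG[unfolded sup_commute[of F]] _ bot(2,1)] by blast
qed

text \<open>The image of \<open>sup F G\<close> is the supremum of the images, so under an initial
  structure F and G are equivalent exactly when their images are. This gives uniqueness; existence
  is the class of F0, whose image is equivalent to G0 by \<open>FG0\<close>.\<close>

lemma ucs_ext_ex1:
  assumes trans: "\<And>F G H. ucs_cauchy S' J' (sup F G) \<Longrightarrow> ucs_cauchy S' J' (sup G H) \<Longrightarrow> F \<noteq> bot \<Longrightarrow> G \<noteq> bot \<Longrightarrow> ucs_cauchy S' J' (sup F H)"
    and initial: "\<And>F. ucs_cauchy S J F \<longleftrightarrow> eventually (\<lambda>x. x \<in> S) F \<and> ucs_cauchy S' J' (filtermap T F)"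
    and F0: "eventually (\<lambda>x. x \<in> S) F0" "F0 \<noteq> bot"
    and G0_bot: "G0 \<noteq> bot" and FG0: "ucs_cauchy S' J' (sup (filtermap T F0) G0)"
  shows "\<exists>!V. V \<in> ucs_completion S J \<and> ucs_ext S' J' T V = ucs_class S' J' G0"
proof -
  have transX: "ucs_cauchy S J (sup F H)"
    if "ucs_cauchy S J (sup F G)" "ucs_cauchy S J (sup G H)" "F \<noteq> bot" "G \<noteq> bot" for F G H
    using that trans[of "filtermap T F" "filtermap T G" "filtermap T H"]
    by (simp add: initial filtermap_sup filtermap_bot_iff eventually_sup)
  have bot: "filtermap T F0 \<noteq> bot" using F0(2) by (simp add: filtermap_bot_iff)
  \<comment> \<open>Passing to G0 and back yields the supremum of the filter with itself, which is
    the filter.\<close>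
  have F0': "ucs_cauchy S' J' (filtermap T F0)"
    using trans[OF FG0 FG0[unfolded sup_commute[of _ G0]] bot G0_bot] by simp
  have G0: "ucs_cauchy S' J' G0"
    using trans[OF FG0[unfolded sup_commute[of _ G0]] FG0 G0_bot bot] by simp
  have eqX: "ucs_class S J F = ucs_class S J G \<longleftrightarrow> ucs_cauchy S J (sup F G)"
    if "ucs_cauchy S J F" "ucs_cauchy S J G" for F G
    by (rule ucs_class_eq_iff[OF transX that])
  have eqY: "ucs_class S' J' F = ucs_class S' J' G \<longleftrightarrow> ucs_cauchy S' J' (sup F G)"
    if "ucs_cauchy S' J' F" "ucs_cauchy S' J' G" for F G
    by (rule ucs_class_eq_iff[OF trans that])
  have ext: "ucs_ext S' J' T (ucs_class S J F) = ucs_class S' J' (filtermap T F)" if F: "ucs_cauchy S J F" for F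
  proof -
    \<comment> \<open>\<open>ucs_ext\<close> evaluates at an arbitrary representative; equivalent
      representatives have equivalent images.\<close>
    define F' where "F' = (SOME F'. F' \<in> ucs_class S J F)"
    have "F \<in> ucs_class S J F" using F by (simp add: ucs_class_def)
    then have "F' \<in> ucs_class S J F" unfolding F'_def by (rule someI)
    then have "ucs_cauchy S J F'" "ucs_cauchy S J (sup F F')" by (auto simp: ucs_class_def)
    then show ?thesis
      using F eqY[of "filtermap T F'" "filtermap T F"]
      unfolding ucs_ext_def F'_def[symmetric] by (simp add: initial filtermap_sup sup_commute)
  qed
  have F0c: "ucs_cauchy S J F0" using F0 F0' by (simp add: initial)
  show ?thesis
  proof (rule ex1I[of _ "ucs_class S J F0"])
    show "ucs_class S J F0 \<in> ucs_completion S J \<and> ucs_ext S' J' T (ucs_class S J F0) = ucs_class S' J' G0"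
      using F0c ext[OF F0c] eqY[OF F0' G0] FG0 by (auto simp: ucs_completion_def)
  next
    fix V assume V: "V \<in> ucs_completion S J \<and> ucs_ext S' J' T V = ucs_class S' J' G0"
    then obtain F where F: "V = ucs_class S J F" "ucs_cauchy S J F" by (auto simp: ucs_completion_def)
    then have "ucs_class S' J' (filtermap T F) = ucs_class S' J' (filtermap T F0)"
      using V ext[OF F(2)] eqY[OF F0' G0] FG0 by simp
    then have "ucs_cauchy S' J' (sup (filtermap T F) (filtermap T F0))"
      using eqY[OF _ F0'] F(2) initial by blast
    then have "ucs_cauchy S J (sup F F0)"
      using F(2) F0c by (simp add: initial filtermap_sup eventually_sup)
    then show "V = ucs_class S J F0" using eqX[OF F(2) F0c] F(1) by simp
  qed
qed

section \<open>Piecewise constant approximate solutions\<close>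

text \<open>Run through a countable base, keep the sets inside S on which a single value works, and
  subtract from each the closure of its predecessors. The resulting cells are open and disjoint, so
  each may receive its own value. They are dense in S: if the complement ?T of the closure of their
  union met S, the first kept set to meet ?T would have predecessors whose closure misses ?T, and
  would leave a part of ?T in its own cell.\<close>

lemma locally_constant_selection:
  fixes S :: "'a::euclidean_space set" and P :: "'a \<Rightarrow> 'b \<Rightarrow> bool"
  assumes S: "open S" and local: "\<And>x. x \<in> S \<Longrightarrow> \<exists>N b. open N \<and> x \<in> N \<and> (\<forall>y\<in>N. P y b)"
  shows "\<exists>D c. open D \<and> D \<subseteq> S \<and> S \<subseteq> closure D \<and> (\<forall>x\<in>D. P x (c x)) \<and>
    (\<forall>x\<in>D. \<exists>N. open N \<and> x \<in> N \<and> N \<subseteq> D \<and> (\<forall>y\<in>N. c y = c x))"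
proof -
  obtain B :: "nat \<Rightarrow> 'a set" where B: "\<And>n. open (B n)" "\<And>T. open T \<Longrightarrow> \<exists>k. T = \<Union>{B n |n. n \<in> k}"
    by (rule univ_second_countable_sequence) blast
  define good where "good n \<longleftrightarrow> B n \<subseteq> S \<and> (\<exists>b. \<forall>y\<in>B n. P y b)" for n
  define G where "G n = (if good n then B n else {})" for n
  define C where "C n = G n - closure (\<Union>m<n. G m)" for n
  define \<beta> where "\<beta> n = (SOME b. \<forall>y\<in>B n. P y b)" for n
  define c where "c x = \<beta> (LEAST n. x \<in> G n)" for x
  have oG: "open (G n)" for n using B(1) by (simp add: G_def)
  have oC: "open (C n)" for n unfolding C_def by (intro open_Diff oG closed_closure)
  have c: "c x = \<beta> n" if "x \<in> C n" for x n
  proof -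
    have "x \<notin> G m" if "m < n" for m
      using \<open>x \<in> C n\<close> closure_subset[of "\<Union>m<n. G m"] that unfolding C_def by blast
    then have "(LEAST n. x \<in> G n) = n"
      using that by (intro Least_equality) (auto simp: C_def not_le[symmetric])
    then show ?thesis by (simp add: c_def)
  qed
  have \<beta>: "P x (\<beta> n)" if "x \<in> C n" for x n
  proof -
    have x: "good n" "x \<in> B n" using that by (auto simp: C_def G_def split: if_splits)
    have "\<forall>y\<in>B n. P y (\<beta> n)" unfolding \<beta>_def by (rule someI_ex) (use x(1) in \<open>simp add: good_def\<close>)
    then show ?thesis using x(2) by blast
  qed
  show ?thesis
  proof (rule exI[of _ "\<Union>n. C n"], rule exI[of _ c], intro conjI ballI)
    show "open (\<Union>n. C n)" by (intro open_UN ballI oC)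
    show "(\<Union>n. C n) \<subseteq> S" by (auto simp: C_def G_def good_def split: if_splits)
    show "P x (c x)" if "x \<in> (\<Union>n. C n)" for x using that c \<beta> by fastforce
    show "\<exists>N. open N \<and> x \<in> N \<and> N \<subseteq> (\<Union>n. C n) \<and> (\<forall>y\<in>N. c y = c x)" if x: "x \<in> (\<Union>n. C n)" for x
    proof -
      obtain n where "x \<in> C n" using x by blast
      then show ?thesis using oC[of n] c by (intro exI[of _ "C n"]) auto
    qed
    show "S \<subseteq> closure (\<Union>n. C n)"
    proof (rule subsetI, rule ccontr)
      fix x assume x: "x \<in> S" "x \<notin> closure (\<Union>n. C n)"
      let ?T = "- closure (\<Union>n. C n)"
      obtain N b where N: "open N" "x \<in> N" "\<forall>y\<in>N. P y b" using local[OF x(1)] by blast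
      obtain k where k: "N \<inter> S = \<Union>{B n |n. n \<in> k}" using B(2)[of "N \<inter> S"] N S by blast
      then obtain n where n: "x \<in> B n" "B n \<subseteq> N \<inter> S" using N x by blast
      then have "good n" unfolding good_def using N(3) by blast
      then have ex: "\<exists>n. G n \<inter> ?T \<noteq> {}" using n x by (intro exI[of _ n]) (auto simp: G_def)
      define n0 where "n0 = (LEAST n. G n \<inter> ?T \<noteq> {})"
      have n0: "G n0 \<inter> ?T \<noteq> {}" unfolding n0_def by (rule LeastI_ex[OF ex])
      have "G m \<inter> ?T = {}" if "m < n0" for m using not_less_Least[of m] that unfolding n0_def by blast
      then have "?T \<inter> (\<Union>m<n0. G m) = {}" by blast
      then have "?T \<inter> closure (\<Union>m<n0. G m) = {}"
        using open_Int_closure_eq_empty[of ?T] by (simp add: open_Compl)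
      then have "G n0 \<inter> ?T \<subseteq> C n0" by (auto simp: C_def)
      then have "G n0 \<inter> ?T \<subseteq> closure (\<Union>n. C n)" using closure_subset[of "\<Union>n. C n"] by blast
      then show False using n0 by blast
    qed
  qed
qed

section \<open>Derivatives of locally constant and locally affine functions\<close>

lemma has_derivative_locally_affine:
  assumes "open N" "x \<in> N" "\<And>y. y \<in> N \<Longrightarrow> h y = k + L y" "bounded_linear L"
  shows "(h has_derivative L) (at x)"
proof -
  have "((\<lambda>y. k + L y) has_derivative L) (at x)"
    using has_derivative_add[OF has_derivative_const[of k] bounded_linear_imp_has_derivative[OF assms(4)]] by simp
  then show ?thesis by (rule has_derivative_transform_within_open[OF _ assms(1,2)]) (simp add: assms(3))
qed

lemma has_derivative_locally_constant:
  assumes "open N" "x \<in> N" "\<And>y. y \<in> N \<Longrightarrow> h y = k"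
  shows "(h has_derivative (\<lambda>_. 0)) (at x)"
  by (rule has_derivative_transform_within_open[OF has_derivative_const assms(1,2)]) (simp add: assms(3))

text \<open>The derivative vanishes on the whole open set A, so it is again locally constant and the
  induction proceeds.\<close>

lemma Ck_locally_constant:
  assumes A: "open A" and "\<And>x. x \<in> A \<Longrightarrow> \<exists>N. open N \<and> x \<in> N \<and> (\<forall>y\<in>N. h y = h x)"
  shows "Ck k A h"
  using assms(2)
proof (induction k arbitrary: h)
  case 0
  have "isCont h x" if x: "x \<in> A" for x
  proof -
    obtain N where N: "open N" "x \<in> N" "\<forall>y\<in>N. h y = h x" using 0 x by blast
    then have "(h has_derivative (\<lambda>_. 0)) (at x)"
      using has_derivative_locally_constant[of N x h "h x"] by blast
    then show ?thesis by (rule has_derivative_continuous)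
  qed
  then show ?case by (simp add: continuous_at_imp_continuous_on)
next
  case (Suc k)
  have deriv: "(h has_derivative (\<lambda>_. 0)) (at x within A)" if x: "x \<in> A" for x
  proof -
    obtain N where N: "open N" "x \<in> N" "\<forall>y\<in>N. h y = h x" using Suc.prems x by blast
    then have "(h has_derivative (\<lambda>_. 0)) (at x)"
      using has_derivative_locally_constant[of N x h "h x"] by blast
    then show ?thesis by (rule has_derivative_at_withinI)
  qed
  have "frechet_derivative h (at x within A) = (\<lambda>_. 0)" if x: "x \<in> A" for x
    using deriv[OF x] unfolding at_within_open[OF x A] by (rule frechet_derivative_at[symmetric])
  then have "Ck k A (\<lambda>x. frechet_derivative h (at x within A) v)" for v
    using A by (intro Suc.IH exI[of _ A]) auto
  then show ?case using deriv by (auto simp: differentiable_def)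
qed

lemma Ck_locally_affine:
  assumes A: "open A"
    and loc: "\<And>x. x \<in> A \<Longrightarrow> \<exists>N L k. open N \<and> x \<in> N \<and> N \<subseteq> A \<and> bounded_linear L \<and> (\<forall>y\<in>N. h y = k + L y)"
  shows "Ck (Suc m) A h"
proof -
  have "h differentiable (at x within A)" if x: "x \<in> A" for x
  proof -
    obtain N L k where N: "open N" "x \<in> N" "bounded_linear L" "\<forall>y\<in>N. h y = k + L y" using loc[OF x] by blast
    have "(h has_derivative L) (at x)" by (rule has_derivative_locally_affine[OF N(1,2) _ N(3)]) (use N(4) in blast)
    then show ?thesis using has_derivative_at_withinI unfolding differentiable_def by blast
  qed
  moreover have "Ck m A (\<lambda>x. frechet_derivative h (at x within A) v)" for v
  proof (rule Ck_locally_constant[OF A])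
    fix x assume x: "x \<in> A"
    obtain N L k where N: "open N" "x \<in> N" "N \<subseteq> A" "bounded_linear L" "\<forall>y\<in>N. h y = k + L y" using loc[OF x] by blast
    have "frechet_derivative h (at y within A) = L" if y: "y \<in> N" for y
    proof -
      have "(h has_derivative L) (at y)" by (rule has_derivative_locally_affine[OF N(1) y _ N(4)]) (use N(5) in blast)
      moreover have "at y within A = at y" using y N(3) by (intro at_within_open A) auto
      ultimately show ?thesis by (metis frechet_derivative_at)
    qed
    then show "\<exists>N. open N \<and> x \<in> N \<and> (\<forall>y\<in>N. frechet_derivative h (at y within A) v = frechet_derivative h (at x within A) v)"
      using N(1,2) by (intro exI[of _ N]) auto
  qed
  ultimately show ?thesis by simp
qed

section \<open>Regularization and density on the half space\<close>

lemma openin_Wt_open: "open D \<Longrightarrow> D \<subseteq> Om \<Longrightarrow> openin Wt D"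
  using openin_WtI[of D] by (simp add: inf_absorb2)

lemma regular_on_ereal:
  assumes "openin Wt D" "continuous_on D g" "\<And>x. x \<in> D \<Longrightarrow> u x = ereal (g x)"
  shows "regular_on Wt D u"
proof (rule regular_onI[OF assms(1)])
  have D: "D \<subseteq> Om" using openin_subset[OF assms(1)] by simp
  have "continuous_on D (\<lambda>x. real_of_ereal (u x))"
    by (rule continuous_on_eq[OF assms(2)]) (simp add: assms(3))
  moreover have "subtopology Wt D = top_of_set D" using D by (simp add: Wt_def subtopology_subtopology inf_absorb2)
  ultimately show "continuous_map (subtopology Wt D) euclideanreal (\<lambda>x. real_of_ereal (u x))" by simp
qed (simp add: assms(3))

text \<open>Continuous bounds known on a dense set hold everywhere after regularization, in
  particular at boundary points outside D. Real bounds make the finite set all of \<open>Om\<close>,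
  hence open; where lo and hi coincide they determine the value.\<close>

lemma IS_sandwich:
  assumes D: "Wt closure_of D = topspace Wt" and reg: "regular_on Wt D u"
    and lo: "continuous_on Om lo" and hi: "continuous_on Om hi"
    and bounds: "\<And>x. x \<in> D \<Longrightarrow> ereal (lo x) \<le> u x \<and> u x \<le> ereal (hi x)"
  shows "IS Wt u \<in> ML0 Wt" "\<And>x. x \<in> Om \<Longrightarrow> ereal (lo x) \<le> IS Wt u x \<and> IS Wt u x \<le> ereal (hi x)"
proof -
  have oOm: "openin Wt Om" using openin_topspace[of Wt] by simp
  note oD = regular_on_open[OF reg]
  show *: "ereal (lo x) \<le> IS Wt u x \<and> IS Wt u x \<le> ereal (hi x)" if x: "x \<in> Om" for x
  proof
    have "IS Wt (\<lambda>x. ereal (lo x)) x \<le> IS Wt u x" "IS Wt u x \<le> IS Wt (\<lambda>x. ereal (hi x)) x"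
      by (rule IS_le_on_dense[OF oD D oOm x]; use bounds in simp)+
    moreover have "IS Wt (\<lambda>x. ereal (lo x)) x = ereal (lo x)" "IS Wt (\<lambda>x. ereal (hi x)) x = ereal (hi x)"
      by (rule IS_regular[OF regular_on_ereal[OF oOm lo] x] IS_regular[OF regular_on_ereal[OF oOm hi] x]; simp)+
    ultimately show "ereal (lo x) \<le> IS Wt u x" "IS Wt u x \<le> ereal (hi x)" by simp_all
  qed
  have fin: "\<bar>IS Wt u x\<bar> \<noteq> \<infinity>" if x: "x \<in> Om" for x
    using *[OF x] by (cases "IS Wt u x") simp_all
  have "{x \<in> topspace Wt. \<bar>IS Wt u x\<bar> \<noteq> \<infinity>} = Om"
  proof (rule set_eqI)
    show "x \<in> {x \<in> topspace Wt. \<bar>IS Wt u x\<bar> \<noteq> \<infinity>} \<longleftrightarrow> x \<in> Om" for x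
      using fin[of x] by (cases "x \<in> Om") simp_all
  qed
  then show "IS Wt u \<in> ML0 Wt" by (intro IS_in_ML0[OF D reg]) (simp only: oOm)
qed

text \<open>Raising t by e/2 keeps a point in the given neighbourhood and moves it into t > 0, where
  D is dense.\<close>

lemma dense_in_Om:
  assumes "open D" "{p. 0 < snd p} \<subseteq> closure D"
  shows "Wt closure_of D = topspace Wt"
  unfolding dense_intersects_open
proof (intro allI impI)
  fix T assume T: "openin Wt T \<and> T \<noteq> {}"
  then obtain T' where T': "open T'" "T = Om \<inter> T'" by (auto simp: Wt_def openin_open)
  obtain a t where at: "(a, t) \<in> T" using T by auto
  then have "(a, t) \<in> T'" using T' by blast
  then obtain e where e: "e > 0" "ball (a, t) e \<subseteq> T'" using T'(1) by (meson open_contains_ball)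
  have "t \<ge> 0" using at T' by (simp add: Om_def)
  then have "(a, t + e / 2) \<in> {p. 0 < snd p}" using e by simp
  then have "(a, t + e / 2) \<in> closure D" using assms(2) by blast
  moreover have "(a, t + e / 2) \<in> T' \<inter> {p. 0 < snd p}"
    using e \<open>t \<ge> 0\<close> by (auto simp: dist_Pair_Pair dist_real_def intro!: subsetD[OF e(2)])
  moreover have "open (T' \<inter> {p :: pt. 0 < snd p})"
    by (intro open_Int T' open_Collect_less continuous_intros)
  ultimately have "T' \<inter> {p. 0 < snd p} \<inter> D \<noteq> {}"
    by (metis disjoint_iff open_Int_closure_eq_empty)
  then show "D \<inter> T \<noteq> {}" unfolding T' Om_def by fastforce
qed

lemma Zset_continuous:
  assumes "w \<in> Zset"
  shows "continuous_on UNIV (\<lambda>x. w x $ j)"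
proof -
  have "Ck (Suc 1) UNIV (\<lambda>x. w x $ j)" using assms by (simp add: Zset_def numeral_2_eq_2)
  then have "(\<lambda>x. w x $ j) differentiable (at x)" for x by simp
  then show ?thesis by (simp add: continuous_at_imp_continuous_on differentiable_imp_continuous_within)
qed

lemma dd_eq:
  assumes "open D" "D \<subseteq> Om" "p \<in> D" "(h has_derivative L) (at p)"
  shows "dd h e p = L e"
  using at_within_open_subset[OF assms(3,1,2)] frechet_derivative_at[OF assms(4)] by (simp add: dd_def)

text \<open>With c = x the left sides vanish at x itself, while t and \<epsilon> are positive, so by
  continuity the conditions persist on a neighbourhood and the selection lemma applies to t > 0. The
  first two errors are bounded by t rather than by \<epsilon> so that they disappear at the
  boundary.\<close>

lemma approximation_points:
  assumes f: "continuous_on Om f" and u0: "u0 \<in> Zset" and \<epsilon>: "\<epsilon> > 0"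
  shows "\<exists>D c. open D \<and> D \<subseteq> Om \<and> Wt closure_of D = topspace Wt \<and>
    (\<forall>x\<in>D. (\<forall>j. \<bar>u0 (fst x) $ j - u0 (fst (c x)) $ j\<bar> \<le> snd x) \<and>
       \<bar>f (c x) \<bullet> (fst x - fst (c x))\<bar> \<le> snd x \<and> (\<forall>i. \<bar>f (c x) $ i - f x $ i\<bar> \<le> \<epsilon>)) \<and>
    (\<forall>x\<in>D. \<exists>N. open N \<and> x \<in> N \<and> N \<subseteq> D \<and> (\<forall>y\<in>N. c y = c x))"
proof -
  let ?S = "{p :: pt. 0 < snd p}"
  define P where "P = (\<lambda>x c. (\<forall>j. \<bar>u0 (fst x) $ j - u0 (fst c) $ j\<bar> \<le> snd x) \<and>
       \<bar>f c \<bullet> (fst x - fst c)\<bar> \<le> snd x \<and> (\<forall>i. \<bar>f c $ i - f x $ i\<bar> \<le> \<epsilon>))"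
  have S: "open ?S" by (intro open_Collect_less continuous_intros)
  have SOm: "?S \<subseteq> Om" by (auto simp: Om_def)
  have fS: "continuous_on ?S f" using f SOm by (rule continuous_on_subset)
  have uS: "continuous_on ?S (\<lambda>y. u0 (fst y) $ j)" for j
    by (rule continuous_on_compose2[OF Zset_continuous[OF u0]]) (auto intro: continuous_intros)
  have pos: "open (?S \<inter> g -` {0<..})" if "continuous_on ?S g" for g :: "pt \<Rightarrow> real"
    using that S open_greaterThan by (rule continuous_open_preimage)
  have "\<exists>N c. open N \<and> x \<in> N \<and> (\<forall>y\<in>N. P y c)" if x: "x \<in> ?S" for x
  proof -
    define A where "A j = ?S \<inter> (\<lambda>y. snd y - \<bar>u0 (fst y) $ j - u0 (fst x) $ j\<bar>) -` {0<..}" for j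
    define B where "B = ?S \<inter> (\<lambda>y. snd y - \<bar>f x \<bullet> (fst y - fst x)\<bar>) -` {0<..}"
    define C where "C i = ?S \<inter> (\<lambda>y. \<epsilon> - \<bar>f x $ i - f y $ i\<bar>) -` {0<..}" for i
    have "open (A j)" "open B" "open (C j)" for j
      unfolding A_def B_def C_def by (intro pos continuous_intros uS fS)+
    then have "open ((\<Inter>j. A j) \<inter> B \<inter> (\<Inter>i. C i))" by (intro open_Int open_INT) auto
    moreover have "x \<in> (\<Inter>j. A j) \<inter> B \<inter> (\<Inter>i. C i)" using x \<epsilon> by (simp add: A_def B_def C_def)
    moreover have "\<forall>y \<in> (\<Inter>j. A j) \<inter> B \<inter> (\<Inter>i. C i). P y x"
      by (auto simp: P_def A_def B_def C_def less_imp_le)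
    ultimately show ?thesis by (intro exI conjI)
  qed
  from locally_constant_selection[where P = P, OF S this]
  obtain D c where D: "open D" "D \<subseteq> ?S" "?S \<subseteq> closure D" "\<forall>x\<in>D. P x (c x)"
    "\<forall>x\<in>D. \<exists>N. open N \<and> x \<in> N \<and> N \<subseteq> D \<and> (\<forall>y\<in>N. c y = c x)"
    by blast
  show ?thesis
    using D(1,4,5) dense_in_Om[OF D(1,3)] subset_trans[OF D(2) SOm] unfolding P_def by (intro exI conjI)
qed

text \<open>Velocity and pressure are prescribed on D and extended by regularization. The extensions
  stay between u0 - t and u0 + t, and between -t and t, so their traces at t = 0 are u0 and 0, both
  of class C^2. The momentum expression equals f(c) on D, within \<epsilon> of f.\<close>

lemma approximate_solution:
  assumes f: "continuous_on Om f" and u0: "u0 \<in> Zset" and \<epsilon>: "\<epsilon> > 0"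
  shows "\<exists>v\<in>Xset. R0 v = u0 \<and>
    (\<forall>i. fst (Top \<nu> v) i \<in> ML0 Wt \<and>
       (\<forall>p\<in>Om. ereal (f p $ i - \<epsilon>) \<le> fst (Top \<nu> v) i p \<and> fst (Top \<nu> v) i p \<le> ereal (f p $ i + \<epsilon>))) \<and>
    snd (Top \<nu> v) \<in> ML0 Wt \<and>
    (\<forall>p\<in>Om. ereal (- \<epsilon>) \<le> snd (Top \<nu> v) p \<and> snd (Top \<nu> v) p \<le> ereal \<epsilon>)"
proof -
  obtain D c where D: "open D" "D \<subseteq> Om" "Wt closure_of D = topspace Wt"
    and u0c: "\<And>x j. x \<in> D \<Longrightarrow> \<bar>u0 (fst x) $ j - u0 (fst (c x)) $ j\<bar> \<le> snd x"
    and fc_small: "\<And>x. x \<in> D \<Longrightarrow> \<bar>f (c x) \<bullet> (fst x - fst (c x))\<bar> \<le> snd x"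
    and fc: "\<And>x i. x \<in> D \<Longrightarrow> \<bar>f (c x) $ i - f x $ i\<bar> \<le> \<epsilon>"
    and c: "\<And>x. x \<in> D \<Longrightarrow> \<exists>N. open N \<and> x \<in> N \<and> N \<subseteq> D \<and> (\<forall>y\<in>N. c y = c x)"
    using approximation_points[OF assms] by metis
  have oD: "openin Wt D" by (rule openin_Wt_open[OF D(1,2)])
  define g where "g j y = u0 (fst (c y)) $ j" for j y
  \<comment> \<open>Normalized to vanish at the spatial point of the cell, so that |q| \<le> t
    becomes a condition on the size of the cell.\<close>
  define q where "q y = f (c y) \<bullet> (fst y - fst (c y))" for y
  define U where "U j = IS Wt (\<lambda>y. ereal (g j y))" for j
  define P where "P = IS Wt (\<lambda>y. ereal (q y))"
  define v :: xel where "v = (U, P)"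
  have const_D: "Ck k D h" if "\<And>x y. x \<in> D \<Longrightarrow> y \<in> D \<Longrightarrow> c y = c x \<Longrightarrow> h y = h x" for k and h :: "pt \<Rightarrow> real"
  proof (rule Ck_locally_constant[OF D(1)])
    fix x assume x: "x \<in> D"
    then obtain N where "open N" "x \<in> N" "N \<subseteq> D" "\<forall>y\<in>N. c y = c x" using c by blast
    then show "\<exists>N. open N \<and> x \<in> N \<and> (\<forall>y\<in>N. h y = h x)" using that[OF x] by blast
  qed
  have lin: "bounded_linear (\<lambda>y :: pt. a \<bullet> fst y)" for a
    by (rule bounded_linear_compose[OF bounded_linear_inner_right bounded_linear_fst])
  have affine_D: "\<exists>N k. open N \<and> x \<in> N \<and> N \<subseteq> D \<and> (\<forall>y\<in>N. q y = k + f (c x) \<bullet> fst y)" if x: "x \<in> D" for x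
  proof -
    obtain N where N: "open N" "x \<in> N" "N \<subseteq> D" "\<forall>y\<in>N. c y = c x" using c[OF x] by blast
    have "\<forall>y\<in>N. q y = - (f (c x) \<bullet> fst (c x)) + f (c x) \<bullet> fst y"
      using N(4) by (simp add: q_def inner_diff_right)
    with N(1-3) show ?thesis by (intro exI conjI)
  qed
  have Ck_affine: "Ck (Suc m) D h" if "\<And>y. y \<in> D \<Longrightarrow> h y = q y" for m and h :: "pt \<Rightarrow> real"
  proof (rule Ck_locally_affine[OF D(1)])
    fix x assume "x \<in> D"
    then obtain N k where N: "open N" "x \<in> N" "N \<subseteq> D" "\<forall>y\<in>N. q y = k + f (c x) \<bullet> fst y"
      using affine_D by blast
    then have "\<forall>y\<in>N. h y = k + f (c x) \<bullet> fst y" using that by auto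
    with N(1-3) lin show "\<exists>N L k. open N \<and> x \<in> N \<and> N \<subseteq> D \<and> bounded_linear L \<and> (\<forall>y\<in>N. h y = k + L y)"
      by (intro exI conjI)
  qed
  have Ck_cont: "continuous_on D h" if "Ck 0 D h" for h :: "pt \<Rightarrow> real" using that by simp
  have contg: "continuous_on D (g j)" for j
    by (intro Ck_cont const_D) (simp add: g_def)
  have contq: "continuous_on D q"
    using Ck_affine[of q 0] by (auto simp: continuous_on_eq_continuous_within intro: differentiable_imp_continuous_within)
  have regU: "regular_on Wt D (\<lambda>y. ereal (g j y))" for j by (rule regular_on_ereal[OF oD contg]) simp
  have regP: "regular_on Wt D (\<lambda>y. ereal (q y))" by (rule regular_on_ereal[OF oD contq]) simp
  have urU: "ur (U j) y = g j y" and urP: "ur P y = q y" if "y \<in> D" for j y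
    using IS_regular[OF regU that] IS_regular[OF regP that] by (simp_all add: U_def P_def)
  have CkU: "Ck k D (ur (U j))" for k j
    by (rule const_D) (simp add: urU g_def)
  have CkP: "Ck 2 D (ur P)"
    unfolding numeral_2_eq_2 by (rule Ck_affine[OF urP])
  have contu0: "continuous_on Om (\<lambda>p. u0 (fst p) $ j)" for j
    by (rule continuous_on_compose2[OF Zset_continuous[OF u0]]) (auto intro: continuous_intros)
  have Ubd: "ereal (u0 (fst x) $ j - snd x) \<le> ereal (g j x) \<and> ereal (g j x) \<le> ereal (u0 (fst x) $ j + snd x)"
    if "x \<in> D" for x j
    using u0c[OF that, of j] by (simp add: g_def abs_le_iff)
  have Pbd: "ereal (- snd x) \<le> ereal (q x) \<and> ereal (q x) \<le> ereal (snd x)" if "x \<in> D" for x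
    using fc_small[OF that] by (simp add: q_def abs_le_iff)
  have cont_snd: "continuous_on Om snd" by (intro continuous_intros)
  have U: "U j \<in> ML0 Wt"
    "x \<in> Om \<Longrightarrow> ereal (u0 (fst x) $ j - snd x) \<le> U j x \<and> U j x \<le> ereal (u0 (fst x) $ j + snd x)" for j x
    unfolding U_def
    by (rule IS_sandwich[OF D(3) regU continuous_on_diff[OF contu0 cont_snd] continuous_on_add[OF contu0 cont_snd]];
      (erule Ubd | assumption))+
  have P: "P \<in> ML0 Wt" "x \<in> Om \<Longrightarrow> ereal (- snd x) \<le> P x \<and> P x \<le> ereal (snd x)" for x
    unfolding P_def
    by (rule IS_sandwich[OF D(3) regP continuous_on_minus[OF cont_snd] cont_snd]; (erule Pbd | assumption))+
  have U_fin: "\<bar>U j x\<bar> \<noteq> \<infinity>" if "x \<in> Om" for j x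
    using U(2)[OF that, of j] by (cases "U j x") simp_all
  have P_fin: "\<bar>P x\<bar> \<noteq> \<infinity>" if "x \<in> Om" for x
    using P(2)[OF that] by (cases "P x") simp_all
  have bdry: "(x, 0) \<in> Om" for x by (simp add: Om_def)
  \<comment> \<open>At t = 0 the two bounds coincide.\<close>
  have U0: "U j (x, 0) = ereal (u0 x $ j)" for j x
    using U(2)[OF bdry, of x j] by (simp add: antisym)
  have P0: "P (x, 0) = 0" for x
    using P(2)[OF bdry, of x] by (simp add: antisym zero_ereal_def)
  have G: "closed_nowhere_dense Wt (Om - D)" "Om - (Om - D) = D"
    using closed_nowhere_dense_Diff[OF oD D(3)] D(2) by auto
  have "U j \<in> ML2_0" for j
    unfolding ML2_0_def mem_Collect_eq
  proof (intro conjI exI[of _ "Om - D"] G(1) U(1) allI ballI)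
    show "Ck 2 UNIV (\<lambda>x. real_of_ereal (U j (x, 0)))"
      using u0 by (simp add: U0 Zset_def)
    show "Ck 2 (Om - (Om - D)) (ur (U j))" unfolding G(2) by (rule CkU)
  qed (rule U_fin, (rule bdry | erule DiffD1))+
  moreover have "P \<in> ML2_0"
    unfolding ML2_0_def mem_Collect_eq
  proof (intro conjI exI[of _ "Om - D"] G(1) P(1) allI ballI)
    show "Ck 2 UNIV (\<lambda>x. real_of_ereal (P (x, 0)))"
      unfolding P0 by (rule Ck_locally_constant[OF open_UNIV]) auto
    show "Ck 2 (Om - (Om - D)) (ur P)" unfolding G(2) by (rule CkP)
  qed (rule P_fin, (rule bdry | erule DiffD1))+
  ultimately have v: "v \<in> Xset" by (simp add: Xset_def v_def)
  have DD: "D \<subseteq> Dset v"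
    using oD CkU CkP D(2) unfolding Dset_def v_def by auto
  have ddU: "dd (ur (U j)) e p = 0" if p: "p \<in> D" for j e p
  proof -
    obtain N where N: "open N" "p \<in> N" "N \<subseteq> D" "\<forall>y\<in>N. c y = c p" using c[OF p] by blast
    have "(ur (U j) has_derivative (\<lambda>_. 0)) (at p)"
      by (rule has_derivative_locally_constant[OF N(1,2), of _ "g j p"]) (use N(3,4) urU in \<open>auto simp: g_def\<close>)
    then show ?thesis by (simp add: dd_eq[OF D(1,2) p])
  qed
  \<comment> \<open>The first derivatives vanish on all of the open set D, not just at p.\<close>
  have ddUU: "dd (\<lambda>y. dd (ur (U j)) e y) e' p = 0" if p: "p \<in> D" for j e e' p
    using has_derivative_locally_constant[OF D(1) p, of "\<lambda>y. dd (ur (U j)) e y" 0] ddU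
    by (simp add: dd_eq[OF D(1,2) p])
  have ddP: "dd (ur P) e p = f (c p) \<bullet> fst e" if p: "p \<in> D" for e p
  proof -
    obtain N k where N: "open N" "p \<in> N" "N \<subseteq> D" "\<forall>y\<in>N. q y = k + f (c p) \<bullet> fst y"
      using affine_D[OF p] by blast
    have "(ur P has_derivative (\<lambda>y. f (c p) \<bullet> fst y)) (at p)"
      by (rule has_derivative_locally_affine[OF N(1,2) _ lin, of _ k]) (use N(3,4) urP in auto)
    then show ?thesis by (rule dd_eq[OF D(1,2) p])
  qed
  have NS: "NS_expr \<nu> v i p = ereal (f (c p) $ i)" if p: "p \<in> D" for i p
  proof -
    have "p \<in> Dset v" using DD p by blast
    moreover have "f (c p) \<bullet> axis i 1 = f (c p) $ i" by (simp add: inner_axis)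
    ultimately show ?thesis using p by (simp add: NS_expr_def v_def ddU ddUU ddP ex_def)
  qed
  have div: "div_expr v p = ereal 0" if p: "p \<in> D" for p
    using DD p by (auto simp: div_expr_def v_def ddU)
  have contfc: "continuous_on D (\<lambda>p. f (c p) $ i)" for i
    by (intro Ck_cont const_D) simp
  have contf: "continuous_on Om (\<lambda>p. f p $ i)" for i by (intro continuous_intros f)
  have NSbd: "ereal (f x $ i - \<epsilon>) \<le> NS_expr \<nu> v i x \<and> NS_expr \<nu> v i x \<le> ereal (f x $ i + \<epsilon>)" if "x \<in> D" for x i
    using fc[OF that, of i] NS[OF that] by (simp add: abs_le_iff)
  have divbd: "ereal (- \<epsilon>) \<le> div_expr v x \<and> div_expr v x \<le> ereal \<epsilon>" if "x \<in> D" for x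
    using div[OF that] \<epsilon> by simp
  have regNS: "regular_on Wt D (NS_expr \<nu> v i)" for i by (rule regular_on_ereal[OF oD contfc NS])
  have regdiv: "regular_on Wt D (div_expr v)" by (rule regular_on_ereal[OF oD continuous_on_const div])
  have "fst (Top \<nu> v) i \<in> ML0 Wt"
    "p \<in> Om \<Longrightarrow> ereal (f p $ i - \<epsilon>) \<le> fst (Top \<nu> v) i p \<and> fst (Top \<nu> v) i p \<le> ereal (f p $ i + \<epsilon>)" for i p
    unfolding Top_def fst_conv
    by (rule IS_sandwich[OF D(3) regNS continuous_on_diff[OF contf continuous_on_const]
          continuous_on_add[OF contf continuous_on_const]]; (erule NSbd | assumption))+
  moreover have "snd (Top \<nu> v) \<in> ML0 Wt"
    "p \<in> Om \<Longrightarrow> ereal (- \<epsilon>) \<le> snd (Top \<nu> v) p \<and> snd (Top \<nu> v) p \<le> ereal \<epsilon>" for p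
    unfolding Top_def snd_conv
    by (rule IS_sandwich[OF D(3) regdiv continuous_on_const continuous_on_const]; (erule divbd | assumption))+
  moreover have "R0 v = u0" by (simp add: R0_def v_def U0 vec_eq_iff fun_eq_iff)
  ultimately show ?thesis using v by (intro bexI[OF _ v] conjI allI ballI) auto
qed

section \<open>Intervals around a continuous function\<close>

definition shifted :: "(pt \<Rightarrow> real) \<Rightarrow> real \<Rightarrow> mlf" where
  "shifted h r = (\<lambda>p. if p \<in> Om then ereal (h p + r) else 0)"

lemma shifted_0: "shifted h 0 = (\<lambda>p. if p \<in> Om then ereal (h p) else 0)"
  by (auto simp: shifted_def)

lemma shifted_in_ML0:
  assumes "continuous_on Om h"
  shows "shifted h r \<in> ML0 Wt"
proof (rule regular_in_ML0)
  have "continuous_on Om (\<lambda>p. h p + r)" by (intro continuous_intros assms)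
  then show "regular_on Wt (topspace Wt) (shifted h r)"
    by (intro regular_on_ereal[of _ "\<lambda>p. h p + r"] openin_topspace) (simp_all add: shifted_def)
qed (simp add: shifted_def)

text \<open>At any single point of an alleged gap, s - r is at most 2/(n+1) for every n.\<close>

lemma bracket_shifted:
  assumes h: "continuous_on Om h"
  shows "bracket (\<lambda>n. shifted h (- inverse (real (Suc n)))) (\<lambda>n. shifted h (inverse (real (Suc n))))"
proof -
  have mono: "shifted h r \<le> shifted h s" if "r \<le> s" for r s
    using that by (auto simp: shifted_def le_fun_def)
  have inv: "inverse (real (Suc n)) \<le> inverse (real (Suc m))" if "m \<le> n" for m n
    using that by (intro le_imp_inverse_le) auto
  have "gapless (\<lambda>n. shifted h (- inverse (real (Suc n)))) (\<lambda>n. shifted h (inverse (real (Suc n))))"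
    unfolding gapless_def
  proof (intro allI impI notI)
    fix V and r s :: real
    assume V: "openin Wt V" "V \<noteq> {}" and rs: "r < s"
      and gap: "\<forall>n. \<forall>x\<in>V. shifted h (- inverse (real (Suc n))) x \<le> ereal r \<and> ereal s \<le> shifted h (inverse (real (Suc n))) x"
    obtain x where x: "x \<in> V" using V by blast
    then have "x \<in> Om" using openin_subset[OF V(1)] by auto
    then have bd: "h x - inverse (real (Suc n)) \<le> r" "s \<le> h x + inverse (real (Suc n))" for n
    proof -
      have "shifted h (- inverse (real (Suc n))) x \<le> ereal r" "ereal s \<le> shifted h (inverse (real (Suc n))) x"
        using gap x by blast+
      then show "h x - inverse (real (Suc n)) \<le> r" "s \<le> h x + inverse (real (Suc n))"
        using \<open>x \<in> Om\<close> by (simp_all add: shifted_def)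
    qed
    obtain n where "inverse (real (Suc n)) < (s - r) / 2" using reals_Archimedean[of "(s - r) / 2"] rs by auto
    moreover have False if "e < (s - r) / 2" "h x - e \<le> r" "s \<le> h x + e" for e using that by argo
    ultimately show False using bd[of n] by blast
  qed
  then show ?thesis
    unfolding bracket_def incseq_def decseq_def
    using shifted_in_ML0[OF h] mono inv by (auto simp del: of_nat_Suc intro!: mono[of "- _" "_"])
qed

text \<open>Joining the principal filter of the limit to the filter of the sequence is how
  \<open>ucs_class\<close> compares a filter with an embedded point. Both lie below the filter of
  the intervals of radius 1/(n+1) around h.\<close>

lemma order_cauchy_shifted:
  assumes h: "continuous_on Om h"
    and w: "\<And>n. w n \<in> ML0 Wt" "\<And>n p. p \<in> Om \<Longrightarrow> ereal (h p - inverse (real (Suc n))) \<le> w n p"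
    "\<And>n p. p \<in> Om \<Longrightarrow> w n p \<le> ereal (h p + inverse (real (Suc n)))"
  shows "order_cauchy (sup (filtermap w sequentially) (principal {shifted h 0}))"
proof -
  let ?\<Sigma> = "\<lambda>n. ointerval (shifted h (- inverse (real (Suc n)))) (shifted h (inverse (real (Suc n))))"
  have conv: "converging ?\<Sigma>" by (rule converging_bracket[OF bracket_shifted[OF h]])
  note dec = converging_decseq[OF conv]
  have mem: "w n \<in> ?\<Sigma> n" for n
    using w ML0_outside[OF w(1)] by (auto simp: ointerval_def le_fun_def shifted_def)
  have "filtermap w sequentially \<le> gen_filter ?\<Sigma>"
    unfolding le_gen_filter[OF dec] eventually_filtermap
  proof
    fix m
    show "\<forall>\<^sub>F n in sequentially. w n \<in> ?\<Sigma> m"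
      using eventually_ge_at_top[of m] by eventually_elim (use mem decseqD[OF dec] in blast)
  qed
  moreover have "shifted h 0 \<in> ?\<Sigma> n" for n
    using shifted_in_ML0[OF h] by (auto simp: ointerval_def le_fun_def shifted_def)
  then have "principal {shifted h 0} \<le> gen_filter ?\<Sigma>"
    unfolding le_gen_filter[OF dec] by (simp add: eventually_principal)
  ultimately have "sup (filtermap w sequentially) (principal {shifted h 0}) \<le> gen_filter ?\<Sigma>" by simp
  moreover have "sup (filtermap w sequentially) (principal {shifted h 0}) \<noteq> bot"
    by (simp add: principal_eq_bot_iff)
  ultimately show ?thesis using conv unfolding order_cauchy_def by blast
qed

text \<open>\<open>T0hat\<close> evaluates \<open>T0\<close> at an arbitrary member of the class,
  and all members share that value.\<close>

lemma T0hat_class: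
  assumes "v \<in> Xset"
  shows "{(v, w). v \<in> Xset \<and> w \<in> Xset \<and> T0 \<nu> v = T0 \<nu> w} `` {v} \<in> XT0 \<nu>"
    "T0hat \<nu> ({(v, w). v \<in> Xset \<and> w \<in> Xset \<and> T0 \<nu> v = T0 \<nu> w} `` {v}) = T0 \<nu> v"
proof -
  let ?R = "{(v, w). v \<in> Xset \<and> w \<in> Xset \<and> T0 \<nu> v = T0 \<nu> w}"
  show "?R `` {v} \<in> XT0 \<nu>" unfolding XT0_def by (rule quotientI[OF assms])
  have "v \<in> ?R `` {v}" using assms by simp
  then have "(SOME w. w \<in> ?R `` {v}) \<in> ?R `` {v}" by (rule someI)
  then have "T0 \<nu> v = T0 \<nu> w" if "w = (SOME w. w \<in> ?R `` {v})" for w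
    unfolding that[symmetric] by simp
  then show "T0hat \<nu> (?R `` {v}) = T0 \<nu> v" by (simp only: T0hat_def)
qed

theorem theorem7:
  fixes \<nu> :: real and f :: "(real^3) \<times> real \<Rightarrow> real^3" and u0 :: "real^3 \<Rightarrow> real^3"
  assumes "continuous_on Om f"
    and "u0 \<in> Zset"
  shows "\<exists>!V. V \<in> ucs_completion (XT0 \<nu>) (JT0 \<nu>) \<and>
              ucs_ext YZset JP (T0hat \<nu>) V = ucs_embed YZset JP (g_of f, u0)"
proof -
  let ?e = "\<lambda>n. inverse (real (Suc n))"
  have "\<forall>n. \<exists>v\<in>Xset. R0 v = u0 \<and>
    (\<forall>i. fst (Top \<nu> v) i \<in> ML0 Wt \<and>
       (\<forall>p\<in>Om. ereal (f p $ i - ?e n) \<le> fst (Top \<nu> v) i p \<and> fst (Top \<nu> v) i p \<le> ereal (f p $ i + ?e n))) \<and>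
    snd (Top \<nu> v) \<in> ML0 Wt \<and>
    (\<forall>p\<in>Om. ereal (- ?e n) \<le> snd (Top \<nu> v) p \<and> snd (Top \<nu> v) p \<le> ereal (?e n))"
    by (intro allI approximate_solution assms) simp
  then obtain v where v: "\<And>n. v n \<in> Xset" "\<And>n. R0 (v n) = u0"
    and T: "\<And>n i. fst (Top \<nu> (v n)) i \<in> ML0 Wt"
      "\<And>n i p. p \<in> Om \<Longrightarrow> ereal (f p $ i - ?e n) \<le> fst (Top \<nu> (v n)) i p"
      "\<And>n i p. p \<in> Om \<Longrightarrow> fst (Top \<nu> (v n)) i p \<le> ereal (f p $ i + ?e n)"
    and T4: "\<And>n. snd (Top \<nu> (v n)) \<in> ML0 Wt"
      "\<And>n p. p \<in> Om \<Longrightarrow> ereal (- ?e n) \<le> snd (Top \<nu> (v n)) p"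
      "\<And>n p. p \<in> Om \<Longrightarrow> snd (Top \<nu> (v n)) p \<le> ereal (?e n)"
    by metis
  define cl where "cl n = {(v, w). v \<in> Xset \<and> w \<in> Xset \<and> T0 \<nu> v = T0 \<nu> w} `` {v n}" for n
  have cl: "cl n \<in> XT0 \<nu>" "T0hat \<nu> (cl n) = T0 \<nu> (v n)" for n
    unfolding cl_def by (rule T0hat_class[OF v(1)])+
  define F where "F = filtermap cl sequentially"
  have TF: "filtermap (T0hat \<nu>) F = filtermap (\<lambda>n. T0 \<nu> (v n)) sequentially"
    by (simp add: F_def filtermap_filtermap cl)
  let ?g = "(g_of f, u0)"
  \<comment> \<open>If this supremum is Cauchy, the values T0 (v n) and the point (g, u0) define the
    same element of the completion.\<close>
  let ?H = "sup (filtermap (\<lambda>n. T0 \<nu> (v n)) sequentially) (principal {?g})"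
  note maps = filtermap_sup filtermap_filtermap filtermap_principal
  have "continuous_on Om (\<lambda>p. f p $ j)" for j by (intro continuous_intros assms)
  then have "order_cauchy (sup (filtermap (\<lambda>n. fst (Top \<nu> (v n)) j) sequentially) (principal {shifted (\<lambda>p. f p $ j) 0}))" for j
    by (rule order_cauchy_shifted) (rule T; assumption?)+
  then have 1: "order_cauchy (filtermap (\<lambda>w. fst (fst w) j) ?H)" for j
    by (simp add: maps T0_def g_of_def shifted_0)
  have "order_cauchy (sup (filtermap (\<lambda>n. snd (Top \<nu> (v n))) sequentially) (principal {shifted (\<lambda>p. 0) 0}))"
    by (rule order_cauchy_shifted) (use T4 in auto)
  moreover have "shifted (\<lambda>p. 0) 0 = (\<lambda>p. 0)" by (auto simp: shifted_def)
  ultimately have 2: "order_cauchy (filtermap (\<lambda>w. snd (fst w)) ?H)"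
    by (simp add: maps T0_def g_of_def)
  \<comment> \<open>Every \<open>R0 (v n)\<close> is u0 itself, so the Z component is principal, as
    \<open>Jl_square\<close> demands.\<close>
  have "filtermap snd ?H = principal {u0}"
  proof (rule filter_eq_principal_singleton)
    show "filtermap snd ?H \<noteq> bot" by (simp add: filtermap_bot_iff principal_eq_bot_iff)
    show "filtermap snd ?H \<le> principal {u0}"
      by (simp add: maps T0_def v le_principal eventually_sup eventually_filtermap eventually_principal)
  qed
  then have "?H \<times>\<^sub>F ?H \<in> JP" unfolding JP_square using 1 2 assms(2) by blast
  then have H: "ucs_cauchy YZset JP (sup (filtermap (T0hat \<nu>) F) (principal {?g}))"
    by (simp only: ucs_cauchy_YZ TF)
  show ?thesis
    unfolding ucs_embed_def
  proof (rule ucs_ext_ex1[OF _ ucs_cauchy_XT0 _ _ _ H])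
    show "ucs_cauchy YZset JP (sup F H)"
      if "ucs_cauchy YZset JP (sup F G)" "ucs_cauchy YZset JP (sup G H)" "F \<noteq> bot" "G \<noteq> bot" for F G H
      using JP_square_trans that unfolding ucs_cauchy_YZ by blast
    show "eventually (\<lambda>c. c \<in> XT0 \<nu>) F" by (simp add: F_def eventually_filtermap cl)
    show "F \<noteq> bot" by (simp add: F_def filtermap_bot_iff)
    show "principal {?g} \<noteq> bot" by (simp add: principal_eq_bot_iff)
  qed
qed

end
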